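(* For every $\delta\in(0,\infty]$ and $\lambda\in(\underline{\lambda},1)$ there exists a constant $c>0$ such that for every $t_0\in\mathbb{Z}$, every plant parameter $\theta_{ab}^*\in\mathcal{S}_{ab}$, all exogenous signals $y^*,w\in\ell_\infty$, every estimator initial condition $\theta_0\in\mathcal{S}$, and every plant initial condition $$x_0=\left[\,y(t_0-1),\dots,y(t_0-n-d+1),\,u(t_0-1),\dots,u(t_0-m-2d+1)\,\right]^T,$$ when the adaptive controller (the estimator together with the $d$-step-ahead adaptive control law, as described in the context) is applied to the plant, the following bound holds: $$\|\phi(k)\|\le c\,\lambda^{k-t_0}\|x_0\|+\sum_{j=t_0}^{k}c\,\lambda^{k-j}\big(|y^*(j)|+|w(j)|\big),\qquad k\ge t_0;$$ furthermore, if $w=0$ then $$\sum_{k=t_0+2d-1}^{\infty}\varepsilon(k)^2\le c\Big(\|x_0\|^2+\sup_{j\ge t_0}|y^*(j)|^2\Big),$$ where $\varepsilon(t)=y^*(t)-y(t)$ is the tracking error.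
   Context: Norms are Euclidean for vectors and induced for matrices; $\ell_\infty$ is the set of bounded real sequences indexed by $\mathbb{Z}$. For a convex compact set $\mathcal{S}\subset\mathbb{R}^p$, $\|\mathcal{S}\|:=\max_{x\in\mathcal{S}}\|x\|$ and $\pi_{\mathcal{S}}$ is the projection onto $\mathcal{S}$. **Plant.** The integers $n$, $m$ and the delay $d\ge1$ are known. The plant is $$\sum_{i=0}^n a_i y(t-i)=\sum_{i=0}^m b_i u(t-d-i)+w(t),\quad t\in\mathbb{Z},$$ with $a_0=1$, $b_0\ne0$, output $y(t)\in\mathbb{R}$, control input $u(t)\in\mathbb{R}$, disturbance $w(t)\in\mathbb{R}$. Put $A(z^{-1})=\sum_{i=0}^n a_iz^{-i}$, $B(z^{-1})=\sum_{i=0}^m b_iz^{-i}$, and $\theta_{ab}^*=[a_1,\dots,a_n,b_0,\dots,b_m]^T$, which lies in a known set $\mathcal{S}_{ab}\subset\mathbb{R}^{n+m+1}$. **Assumption.** $\mathcal{S}_{ab}$ is compact, and for each element of $\mathcal{S}_{ab}$ the corresponding $B(z^{-1})$ has all its zeros (in the variable $z$) in the open unit disk, and the sign of $b_0$ is the same for all elements of $\mathcal{S}_{ab}$. Define $\underline{\lambda}:=\max_{\theta_{ab}^*\in\mathcal{S}_{ab}}\{|\lambda|:B(\lambda^{-1})=0\}$. **Predictor form.** Let $F(z^{-1})=\sum_{i=0}^{d-1}f_iz^{-i}$ and $G(z^{-1})=\sum_{i=0}^{n-1}g_iz^{-i}$ be the polynomials with $\frac{1}{A(z^{-1})}=F(z^{-1})+z^{-d}\frac{G(z^{-1})}{A(z^{-1})}$.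 Let $\sum_{i=0}^{m+d-1}\beta_iz^{-i}:=F(z^{-1})B(z^{-1})$, $\alpha_i:=g_i$, and $\bar w(t):=f_0w(t+d)+\cdots+f_{d-1}w(t+1)$. With $$\phi(t)=[y(t),\dots,y(t-n+1),u(t),\dots,u(t-m-d+1)]^T,\quad \theta^*=[\alpha_0,\dots,\alpha_{n-1},\beta_0,\dots,\beta_{m+d-1}]^T,$$ the plant becomes $y(t+d)=\phi(t)^T\theta^*+\bar w(t)$. Let $\mathcal{S}_{\alpha\beta}$ be the set of all $\theta^*$ arising from $\theta_{ab}^*\in\mathcal{S}_{ab}$, and let $\mathcal{S}\subset\mathbb{R}^{n+m+d}$ be a fixed compact convex set containing $\mathcal{S}_{\alpha\beta}$ on which the $(n+1)$-th coordinate (corresponding to $\beta_0$) is never zero. **Estimator.** With $\hat\theta(t_0-1)=\theta_0$, for $t\ge t_0-1$ let $e(t+1):=y(t+1)-\phi(t-d+1)^T\hat\theta(t)$, $$\rho_\delta(\phi(t-d+1),e(t+1)):=\begin{cases}1&\text{if }|e(t+1)|<(2\|\mathcal{S}\|+\delta)\|\phi(t-d+1)\|,\\0&\text{otherwise,}\end{cases}$$ (with the convention $\infty\times0=0$ if $\delta=\infty$), $$\check\theta(t+1)=\hat\theta(t)+\rho_\delta(\phi(t-d+1),e(t+1))\frac{\phi(t-d+1)}{\|\phi(t-d+1)\|^2}e(t+1),\qquad \hat\theta(t+1)=\pi_{\mathcal{S}}(\check\theta(t+1)),$$ where the update term is understood to be zero when $\rho_\delta=0$. **Control law.** For $t\ge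 t_0$, $u(t)$ is determined by $y^*(t+d)=\hat\theta(t)^T\phi(t)$ (solvable because the $(n+1)$-th entry of $\hat\theta(t)$ is nonzero), where $y^*$ is the exogenous reference signal, known $d$ steps in advance.
   Formalization: In the bound on φ(k), |y*(j)| is replaced by |y*(j+d)|, since u(k) depends on y*(k+d); the printed bound fails at k = t0 for x0 = 0, w = 0 and y* zero except y*(t0+d) = 1. *)

theory Defs
  imports
    "HOL-Analysis.Analysis"
    "HOL-Computational_Algebra.Polynomial_FPS"
begin

text \<open>
  A vector of \<open>\<real>\<^sup>p\<close> is an element of \<open>real ^ 'k\<close> with \<open>CARD('k) = p\<close>. The library's enumeration
  \<open>to_nat_on UNIV :: 'k \<Rightarrow> nat\<close>, a bijection onto \<open>{..<p}\<close>, numbers the coordinates, starting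
  from 0; the two lemmas below state that \<open>mkvec\<close> and \<open>coord\<close> are mutually inverse.
\<close>

definition mkvec :: "(nat \<Rightarrow> real) \<Rightarrow> real ^ 'k::finite" where
  "mkvec f = (\<chi> i. f (to_nat_on UNIV i))"

definition coord :: "real ^ 'k::finite \<Rightarrow> nat \<Rightarrow> real" where
  "coord v i = vec_nth v (from_nat_into UNIV i)"

lemma coord_mkvec:
  assumes "i < CARD('k::finite)"
  shows "coord (mkvec f :: real ^ 'k) i = f i"
proof -
  have "to_nat_on (UNIV :: 'k set) ` UNIV = {..<CARD('k)}"
    using to_nat_on_finite[of "UNIV :: 'k set"] by (simp add: bij_betw_def)
  then have "i \<in> to_nat_on (UNIV :: 'k set) ` UNIV"
    using assms by simp
  then show ?thesis
    by (simp add: coord_def mkvec_def to_nat_on_from_nat_into)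
qed

lemma mkvec_coord: "mkvec (coord v) = (v :: real ^ 'k::finite)"
  by (simp add: vec_eq_iff coord_def mkvec_def)


text \<open>
  Plant parameter \<open>\<theta>\<^sub>a\<^sub>b = [a\<^sub>1, \<dots>, a\<^sub>n, b\<^sub>0, \<dots>, b\<^sub>m]\<close>, with \<open>a\<^sub>0 = 1\<close>. Polynomials in the delay operator
  have \<open>z\<^sup>-\<^sup>1\<close> as their indeterminate.
\<close>

definition a_coef :: "real ^ 'q::finite \<Rightarrow> nat \<Rightarrow> real" where
  "a_coef \<theta>ab i = (if i = 0 then 1 else coord \<theta>ab (i - 1))"

definition b_coef :: "nat \<Rightarrow> real ^ 'q::finite \<Rightarrow> nat \<Rightarrow> real" where
  "b_coef n \<theta>ab i = coord \<theta>ab (n + i)"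

definition A_poly :: "nat \<Rightarrow> real ^ 'q::finite \<Rightarrow> real poly" where
  "A_poly n \<theta>ab = (\<Sum>i\<le>n. monom (a_coef \<theta>ab i) i)"

definition B_poly :: "nat \<Rightarrow> nat \<Rightarrow> real ^ 'q::finite \<Rightarrow> real poly" where
  "B_poly n m \<theta>ab = (\<Sum>i\<le>m. monom (b_coef n \<theta>ab i) i)"

definition B_zeros :: "nat \<Rightarrow> nat \<Rightarrow> real ^ 'q::finite \<Rightarrow> complex set" where
  "B_zeros n m \<theta>ab =
     {z. z \<noteq> 0 \<and> poly (map_poly complex_of_real (B_poly n m \<theta>ab)) (inverse z) = 0}"

text \<open>
  The supremum of the moduli is a maximum, being taken over a compact parameter set with
  \<open>b\<^sub>0 \<noteq> 0\<close>. The element 0 does not affect it, except that it fixes the value 0 when no \<open>B\<close> has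
  a zero (for example if \<open>m = 0\<close>).
\<close>

definition lambda_low :: "nat \<Rightarrow> nat \<Rightarrow> (real ^ 'q::finite) set \<Rightarrow> real" where
  "lambda_low n m Sab = Sup (insert 0 (\<Union>\<theta>ab\<in>Sab. cmod ` B_zeros n m \<theta>ab))"


text \<open>The identity \<open>1/A = F + z\<^sup>-\<^sup>d G/A\<close> is read in the ring of power series in \<open>z\<^sup>-\<^sup>1\<close>.\<close>

definition predictor_polys ::
  "nat \<Rightarrow> nat \<Rightarrow> real ^ 'q::finite \<Rightarrow> real poly \<Rightarrow> real poly \<Rightarrow> bool" where
  "predictor_polys n d \<theta>ab F G \<longleftrightarrow>
     (\<forall>i\<ge>d. coeff F i = 0) \<and> (\<forall>i\<ge>n. coeff G i = 0) \<and>
     1 / fps_of_poly (A_poly n \<theta>ab) =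
       fps_of_poly F + fps_X ^ d * (fps_of_poly G / fps_of_poly (A_poly n \<theta>ab))"

definition S_alphabeta ::
  "nat \<Rightarrow> nat \<Rightarrow> nat \<Rightarrow> (real ^ 'q::finite) set \<Rightarrow> (real ^ 'p::finite) set" where
  "S_alphabeta n m d Sab =
     {mkvec (\<lambda>i. if i < n then coeff G i else coeff (F * B_poly n m \<theta>ab) (i - n)) | \<theta>ab F G.
        \<theta>ab \<in> Sab \<and> predictor_polys n d \<theta>ab F G}"


text \<open>\<open>\<phi>(t) = [y(t), \<dots>, y(t-n+1), u(t), \<dots>, u(t-m-d+1)]\<close>; its length \<open>n+m+d\<close> is that of \<open>'p\<close>.\<close>

definition regressor ::
  "nat \<Rightarrow> (int \<Rightarrow> real) \<Rightarrow> (int \<Rightarrow> real) \<Rightarrow> int \<Rightarrow> real ^ 'p::finite" where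
  "regressor n y u t = mkvec (\<lambda>i. if i < n then y (t - int i) else u (t - int (i - n)))"

text \<open>
  \<open>x\<^sub>0 = [y(t\<^sub>0-1), \<dots>, y(t\<^sub>0-n-d+1), u(t\<^sub>0-1), \<dots>, u(t\<^sub>0-m-2d+1)]\<close>, with \<open>n+d-1\<close> outputs followed by
  \<open>m+2d-1\<close> inputs.
\<close>

definition plant_init ::
  "nat \<Rightarrow> nat \<Rightarrow> (int \<Rightarrow> real) \<Rightarrow> (int \<Rightarrow> real) \<Rightarrow> int \<Rightarrow> real ^ 'r::finite" where
  "plant_init n d y u t0 =
     mkvec (\<lambda>i. if i < n + d - 1 then y (t0 - 1 - int i)
                else u (t0 - 1 - int (i - (n + d - 1))))"

definition set_norm :: "'a::real_normed_vector set \<Rightarrow> real" where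
  "set_norm S = Sup (norm ` S)"

text \<open>In \<open>ereal\<close> the library convention is \<open>\<infinity> * 0 = 0\<close>.\<close>

definition rho :: "ereal \<Rightarrow> 'a::real_normed_vector set \<Rightarrow> 'a \<Rightarrow> real \<Rightarrow> real" where
  "rho \<delta> S \<phi> e =
     (if ereal \<bar>e\<bar> < (ereal (2 * set_norm S) + \<delta>) * ereal (norm \<phi>) then 1 else 0)"

definition pred_error ::
  "nat \<Rightarrow> nat \<Rightarrow> (int \<Rightarrow> real) \<Rightarrow> (int \<Rightarrow> real) \<Rightarrow> (int \<Rightarrow> real ^ 'p::finite) \<Rightarrow> int \<Rightarrow> real" where
  "pred_error n d y u \<theta>hat t = y t - regressor n y u (t - int d) \<bullet> \<theta>hat (t - 1)"

definition theta_check ::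
  "nat \<Rightarrow> nat \<Rightarrow> ereal \<Rightarrow> (real ^ 'p::finite) set \<Rightarrow> (int \<Rightarrow> real) \<Rightarrow> (int \<Rightarrow> real) \<Rightarrow>
   (int \<Rightarrow> real ^ 'p) \<Rightarrow> int \<Rightarrow> real ^ 'p" where
  "theta_check n d \<delta> S y u \<theta>hat t =
     (let \<phi> = regressor n y u (t - int d); e = pred_error n d y u \<theta>hat t
      in \<theta>hat (t - 1) + (rho \<delta> S \<phi> e * e / (norm \<phi>)\<^sup>2) *\<^sub>R \<phi>)"

text \<open>
  The signals \<open>y\<close>, \<open>u\<close> before time \<open>t\<^sub>0\<close> are arbitrary: they form the plant initial condition, so
  the plant equation is imposed from \<open>t\<^sub>0\<close> on only.

  Note that \<open>u(t)\<close>, an entry of \<open>\<phi>(t)\<close>, is determined by the future reference value \<open>y\<^sup>*(t+d)\<close>. A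
  bound on \<open>\<phi>(k)\<close> must therefore involve the reference up to time \<open>k+d\<close>: the exogenous signal
  that drives the loop at time \<open>j\<close> is \<open>y\<^sup>*(j+d)\<close>.
\<close>

definition closed_loop ::
  "nat \<Rightarrow> nat \<Rightarrow> nat \<Rightarrow> real ^ 'q::finite \<Rightarrow> ereal \<Rightarrow> (real ^ 'p::finite) set \<Rightarrow> int \<Rightarrow> real ^ 'p \<Rightarrow>
   (int \<Rightarrow> real) \<Rightarrow> (int \<Rightarrow> real) \<Rightarrow> (int \<Rightarrow> real) \<Rightarrow> (int \<Rightarrow> real) \<Rightarrow> (int \<Rightarrow> real ^ 'p) \<Rightarrow> bool" where
  "closed_loop n m d \<theta>ab \<delta> S t0 \<theta>0 ystar w y u \<theta>hat \<longleftrightarrow>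
     (\<forall>t\<ge>t0. (\<Sum>i\<le>n. a_coef \<theta>ab i * y (t - int i)) =
             (\<Sum>i\<le>m. b_coef n \<theta>ab i * u (t - int d - int i)) + w t) \<and>
     \<theta>hat (t0 - 1) = \<theta>0 \<and>
     (\<forall>t\<ge>t0 - 1. \<theta>hat (t + 1) = closest_point S (theta_check n d \<delta> S y u \<theta>hat (t + 1))) \<and>
     (\<forall>t\<ge>t0. ystar (t + int d) = \<theta>hat t \<bullet> regressor n y u t)"

end

theory Submission
  imports Defs "HOL-Computational_Algebra.Fundamental_Theorem_Algebra"
begin

text \<open>
  Fix \<open>L\<close> strictly between \<open>\<lambda>_low\<close> and \<open>\<lambda>\<close> and discount all signals by \<open>L\<^sup>-\<^sup>t\<close>. Since \<open>B\<close> has a stable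
  inverse with rate below \<open>L\<close>, the discounted regressor norm is bounded by a past value plus sums of
  outputs and exogenous signals, and the output at time \<open>t\<close> is \<open>y\<^sup>*(t)\<close> plus \<open>\<parallel>\<phi>(t-d)\<parallel>\<close> times the sum of
  the last \<open>d\<close> parameter updates, up to the disturbance.

  To bound the regressor at time \<open>k\<close>, go back to the last time \<open>s\<close> at which it was below \<open>M\<close> times the
  convolution bound. On \<open>(s, k]\<close> the disturbance is small relative to the regressor, so the squared
  parameter error decreases by half the squared update up to a small term; hence the updates over any
  subwindow of length \<open>l\<close> sum to at most \<open>2\<epsilon>l + const\<close>. A discrete Gronwall inequality then
  costs a factor \<open>(\<lambda>/L)\<^sup>l\<close> only. If \<open>w = 0\<close>, the updates are square summable, and the tracking error is
  bounded by the bounded regressor times a sum of updates.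
\<close>

subsection \<open>Stable inverse filters\<close>

text \<open>The obstacle is the disturbance: with it the parameter error need not decrease, and the
  updates need not be square summable. Descent is available only while the regressor dominates the
  exogenous signals, so the analysis is confined to the stretch after the last time \<open>s\<close>
  at which it did not. Starting over at \<open>s\<close> loses only one factor, because the
  comparison signal \<open>exp_conv\<close> solves a first-order recursion and can be restarted at
  \<open>s\<close> from its own value. The gap between \<open>L\<close> and \<open>lam\<close> is
  the reserve that pays for adaptation: \<open>eps\<close> is chosen so that the Gronwall exponent
  grows by exactly \<open>ln (lam / L)\<close> per step, and \<open>M\<close> then so large that the
  disturbance relative to the regressor stays below \<open>eps\<close>. Since one constant must
  serve all plants, references and starting times, every constant is an explicit expression in
  bounds shared by the compact sets \<open>Sab\<close> and \<open>S\<close>; this is why the gains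
  are definitions and not existential witnesses.\<close>

definition lag_op :: "'a::comm_ring_1 poly \<Rightarrow> (int \<Rightarrow> 'a) \<Rightarrow> int \<Rightarrow> 'a" where
  "lag_op p u t = (\<Sum>i\<le>degree p. coeff p i * u (t - int i))"

lemma lag_op_altdef:
  assumes "degree p \<le> N"
  shows "lag_op p u t = (\<Sum>i\<le>N. coeff p i * u (t - int i))"
  unfolding lag_op_def
  by (rule sum.mono_neutral_left) (use assms in \<open>auto simp: coeff_eq_0\<close>)

lemma lag_op_0 [simp]: "lag_op 0 u t = 0"
  by (simp add: lag_op_def)

lemma lag_op_pCons: "lag_op (pCons a p) u t = a * u t + lag_op p u (t - 1)"
proof -
  have "lag_op (pCons a p) u t = (\<Sum>i\<le>Suc (degree p). coeff (pCons a p) i * u (t - int i))"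
    by (rule lag_op_altdef) (simp add: degree_pCons_le)
  also have "\<dots> = a * u t + (\<Sum>i\<le>degree p. coeff p i * u (t - 1 - int i))"
    by (subst sum.atMost_Suc_shift) (simp add: algebra_simps)
  finally show ?thesis
    by (simp add: lag_op_def)
qed

lemma lag_op_add: "lag_op (p + q) u t = lag_op p u t + lag_op q u t"
proof -
  let ?N = "max (degree p) (degree q)"
  have "lag_op (p + q) u t = (\<Sum>i\<le>?N. coeff (p + q) i * u (t - int i))"
    by (rule lag_op_altdef) (simp add: degree_add_le)
  then show ?thesis
    by (simp add: lag_op_altdef[of p ?N] lag_op_altdef[of q ?N] sum.distrib algebra_simps)
qed

lemma lag_op_smult: "lag_op (smult c p) u t = c * lag_op p u t"
  unfolding lag_op_altdef[OF degree_smult_le] by (simp add: lag_op_def sum_distrib_left mult.assoc)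

text \<open>Together with additivity this makes polynomials act on signals as a ring: a
  factorization of a polynomial splits its filter into first-order ones, and a Bezout identity
  becomes an identity between filtered signals.\<close>

lemma lag_op_mult: "lag_op (p * q) u t = lag_op p (lag_op q u) t"
proof (induction p arbitrary: t)
  case (pCons a p)
  then show ?case
    by (simp add: lag_op_add lag_op_smult lag_op_pCons)
qed simp

lemma lag_op_monom: "lag_op (monom c k) u t = c * u (t - int k)"
  by (induction k arbitrary: t) (simp_all add: monom_Suc lag_op_pCons monom_0 algebra_simps)

text \<open>For a fixed lag the times visited are a shifted copy of \<open>I\<close> inside
  \<open>H\<close>, so each value of \<open>v\<close> is counted at most once per lag.\<close>

lemma sum_lag_le:
  fixes v :: "int \<Rightarrow> real"
  assumes v: "\<And>t. 0 \<le> v t" and sub: "\<And>t i. t \<in> I \<Longrightarrow> i \<in> J \<Longrightarrow> t - int i \<in> H"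
    and fin: "finite H" "finite J" "finite I"
  shows "(\<Sum>t\<in>I. \<Sum>i\<in>J. v (t - int i)) \<le> real (card J) * sum v H"
proof -
  have "(\<Sum>t\<in>I. \<Sum>i\<in>J. v (t - int i)) = (\<Sum>i\<in>J. \<Sum>t\<in>I. v (t - int i))"
    by (rule sum.swap)
  also have "\<dots> \<le> (\<Sum>i\<in>J. sum v H)"
  proof (rule sum_mono)
    fix i assume i: "i \<in> J"
    have "(\<Sum>t\<in>I. v (t - int i)) = sum v ((\<lambda>t. t - int i) ` I)"
      by (subst sum.reindex) (auto simp: inj_on_def)
    also have "\<dots> \<le> sum v H"
      by (rule sum_mono2) (use v sub i fin in auto)
    finally show "(\<Sum>t\<in>I. v (t - int i)) \<le> sum v H" .
  qed
  finally show ?thesis by simp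
qed

section \<open>Summation bounds for inverse filters\<close>

text \<open>The shifted sum is at most the sum itself plus the one value before the window, so the
  left side reappears on the right with a factor \<open>\<mu> < 1\<close> and is absorbed.\<close>

lemma first_order_filter:
  fixes u :: "int \<Rightarrow> complex"
  assumes c: "cmod c \<le> \<mu>" and \<mu>: "0 \<le> \<mu>" "\<mu> < 1"
  shows "(\<Sum>t\<in>{T..K}. cmod (u t)) \<le>
    (1 / (1 - \<mu>)) * (cmod (u (T - 1)) + (\<Sum>t\<in>{T..K}. cmod (u t - c * u (t - 1))))"
proof -
  let ?s = "\<Sum>t\<in>{T..K}. cmod (u t)"
  have "?s \<le> (\<Sum>t\<in>{T..K}. cmod (u t - c * u (t - 1)) + \<mu> * cmod (u (t - 1)))"
  proof (rule sum_mono)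
    fix t
    have "cmod (u t) \<le> cmod (u t - c * u (t - 1)) + cmod (c * u (t - 1))"
      by (metis diff_add_cancel norm_triangle_ineq)
    also have "cmod (c * u (t - 1)) \<le> \<mu> * cmod (u (t - 1))"
      using c by (simp add: norm_mult mult_right_mono)
    finally show "cmod (u t) \<le> cmod (u t - c * u (t - 1)) + \<mu> * cmod (u (t - 1))" by simp
  qed
  also have "\<dots> = (\<Sum>t\<in>{T..K}. cmod (u t - c * u (t - 1))) + \<mu> * (\<Sum>t\<in>{T..K}. cmod (u (t - 1)))"
    by (simp add: sum.distrib sum_distrib_left)
  also have "(\<Sum>t\<in>{T..K}. cmod (u (t - 1))) \<le> cmod (u (T - 1)) + ?s"
  proof -
    have "(\<Sum>t\<in>{T..K}. cmod (u (t - 1))) = (\<Sum>t\<in>(\<lambda>t. t - 1) ` {T..K}. cmod (u t))"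
      by (subst sum.reindex) (auto simp: inj_on_def)
    also have "\<dots> \<le> (\<Sum>t\<in>insert (T - 1) {T..K}. cmod (u t))"
      by (rule sum_mono2) auto
    finally show ?thesis by simp
  qed
  finally have "?s \<le> (\<Sum>t\<in>{T..K}. cmod (u t - c * u (t - 1))) + \<mu> * (cmod (u (T - 1)) + ?s)"
    using \<mu> by (simp add: mult_left_mono)
  moreover have "\<mu> * cmod (u (T - 1)) \<le> cmod (u (T - 1))"
    using \<mu> by (simp add: mult_left_le_one_le)
  ultimately have "(1 - \<mu>) * ?s \<le> cmod (u (T - 1)) + (\<Sum>t\<in>{T..K}. cmod (u t - c * u (t - 1)))"
    by (simp add: algebra_simps)
  then show ?thesis
    using \<mu> by (simp add: field_simps)
qed

text \<open>The indeterminate is the delay, so stability puts the roots outside the disk of radius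
  \<open>1 / \<mu>\<close>; for \<open>\<mu> = 0\<close> there are none. The induction peels off one
  complex root at a time. Each root costs \<open>3 / (1 - \<mu>)\<close>: the initial values of the
  partially filtered signal \<open>v\<close> count those of \<open>u\<close> twice, and
  \<open>first_order_filter\<close> needs one more value of \<open>u\<close>.\<close>

lemma stable_filter_degree:
  fixes p :: "complex poly"
  assumes \<mu>: "0 \<le> \<mu>" "\<mu> < 1"
  shows "\<lbrakk>degree p = m; coeff p 0 = 1; \<And>z. poly p z = 0 \<Longrightarrow> 1 \<le> \<mu> * cmod z\<rbrakk> \<Longrightarrow>
    (\<Sum>t\<in>{T..K}. cmod (u t)) \<le>
      (3 / (1 - \<mu>)) ^ m * ((\<Sum>i=1..m. cmod (u (T - int i))) + (\<Sum>t\<in>{T..K}. cmod (lag_op p u t)))"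
proof (induction m arbitrary: p u)
  case 0
  then obtain c where "p = [:c:]" by (auto elim: degree_eq_zeroE)
  with 0 show ?case by (simp add: lag_op_pCons)
next
  case (Suc m)
  obtain z where z: "poly p z = 0"
    using fundamental_theorem_of_algebra[of p] Suc.prems(1) by (auto simp: constant_degree)
  with Suc.prems(3) have z1: "1 \<le> \<mu> * cmod z" by blast
  then have z0: "z \<noteq> 0" by auto
  from z obtain q' where q': "p = [:-z, 1:] * q'"
    unfolding poly_eq_0_iff_dvd by (auto elim: dvdE)
  \<comment> \<open>Rescaling gives the linear factor constant term 1, so that \<open>q\<close>
    inherits the normalization the induction hypothesis asks for.\<close>
  define q where "q = smult (- z) q'"
  have p_eq: "p = q * [:1, - inverse z:]"
    unfolding q_def q' using z0 by (simp add: algebra_simps)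
  have q0: "q \<noteq> 0" using p_eq Suc.prems(1) by auto
  have deg: "degree q = m"
    using Suc.prems(1) q0 z0 unfolding p_eq by (subst (asm) degree_mult_eq) auto
  have "coeff p 0 = coeff q 0"
    unfolding p_eq by (simp add: coeff_mult)
  then have q1: "coeff q 0 = 1" using Suc.prems(2) by simp
  have qz: "1 \<le> \<mu> * cmod x" if "poly q x = 0" for x
    by (rule Suc.prems(3)) (simp add: p_eq that)
  define v where "v t = u t - inverse z * u (t - 1)" for t
  have v_lag: "v = lag_op [:1, - inverse z:] u"
    by (auto simp: v_def lag_op_pCons)
  let ?\<kappa> = "1 / (1 - \<mu>)" and ?C = "(3 / (1 - \<mu>)) ^ m"
  let ?U = "\<Sum>i=1..Suc m. cmod (u (T - int i))"
  let ?P = "\<Sum>t\<in>{T..K}. cmod (lag_op p u t)"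
  have C1: "1 \<le> ?C" by (rule one_le_power) (use \<mu> in \<open>simp add: field_simps\<close>)
  have U0: "0 \<le> ?U" and P0: "0 \<le> ?P" by (simp_all add: sum_nonneg)
  have lag_eq: "lag_op q v t = lag_op p u t" for t
    unfolding v_lag p_eq lag_op_mult ..
  have inv: "cmod (inverse z) \<le> \<mu>"
    using z1 z0 by (simp add: norm_inverse norm_divide field_simps)
  have "(\<Sum>i=1..m. cmod (v (T - int i))) \<le> (\<Sum>i=1..m. cmod (u (T - int i)) + cmod (u (T - int (Suc i))))"
  proof (rule sum_mono)
    fix i
    have "cmod (v (T - int i)) \<le> cmod (u (T - int i)) + cmod (inverse z * u (T - int i - 1))"
      unfolding v_def by (rule norm_triangle_ineq4)
    also have "cmod (inverse z * u (T - int i - 1)) \<le> 1 * cmod (u (T - int i - 1))"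
      unfolding norm_mult by (rule mult_right_mono) (use inv \<mu> in auto)
    finally show "cmod (v (T - int i)) \<le> cmod (u (T - int i)) + cmod (u (T - int (Suc i)))"
      by (simp add: algebra_simps)
  qed
  also have "\<dots> = (\<Sum>i=1..m. cmod (u (T - int i))) + (\<Sum>i=Suc 1..Suc m. cmod (u (T - int i)))"
    by (simp only: sum.distrib sum.shift_bounds_cl_Suc_ivl)
  also have "\<dots> \<le> ?U + ?U"
    by (intro add_mono sum_mono2) auto
  finally have v_init: "(\<Sum>i=1..m. cmod (v (T - int i))) \<le> 2 * ?U" by simp
  have "(\<Sum>t\<in>{T..K}. cmod (v t)) \<le> ?C * ((\<Sum>i=1..m. cmod (v (T - int i))) + ?P)"
    using Suc.IH[OF deg q1 qz, of v] by (simp add: lag_eq)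
  also have "\<dots> \<le> ?C * (2 * ?U + ?P)"
    using v_init C1 by (intro mult_left_mono) auto
  finally have v_sum: "(\<Sum>t\<in>{T..K}. cmod (v t)) \<le> ?C * (2 * ?U + ?P)" .
  have "cmod (u (T - int 1)) \<le> ?U"
    by (rule member_le_sum) auto
  then have u1: "cmod (u (T - 1)) \<le> ?C * ?U"
    using mult_right_mono[OF C1 U0] by simp
  have "(\<Sum>t\<in>{T..K}. cmod (u t)) \<le> ?\<kappa> * (cmod (u (T - 1)) + (\<Sum>t\<in>{T..K}. cmod (v t)))"
    unfolding v_def by (rule first_order_filter[OF inv \<mu>])
  also have "\<dots> \<le> ?\<kappa> * (?C * ?U + ?C * (2 * ?U + ?P))"
    using u1 v_sum \<mu> by (intro mult_left_mono add_mono) auto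
  also have "\<dots> \<le> ?\<kappa> * (3 * (?C * (?U + ?P)))"
    using C1 P0 \<mu> by (intro mult_left_mono) (auto simp: algebra_simps)
  also have "\<dots> = (3 / (1 - \<mu>)) ^ Suc m * (?U + ?P)"
    by simp
  finally show ?case .
qed

text \<open>The top coefficients of \<open>B\<close> may vanish for some parameters, so its degree
  can vary over the parameter set. As \<open>3 / (1 - \<mu>) \<ge> 1\<close>, the bound
  \<open>m\<close> can replace the degree, which keeps the constant uniform.\<close>

lemma stable_filter:
  fixes p :: "complex poly"
  assumes \<mu>: "0 \<le> \<mu>" "\<mu> < 1"
    and "degree p \<le> m" "coeff p 0 = 1" "\<And>z. poly p z = 0 \<Longrightarrow> 1 \<le> \<mu> * cmod z"
  shows "(\<Sum>t\<in>{T..K}. cmod (u t)) \<le>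
      (3 / (1 - \<mu>)) ^ m * ((\<Sum>i=1..m. cmod (u (T - int i))) + (\<Sum>t\<in>{T..K}. cmod (lag_op p u t)))"
proof -
  let ?P = "\<Sum>t\<in>{T..K}. cmod (lag_op p u t)"
  have "(\<Sum>t\<in>{T..K}. cmod (u t)) \<le>
      (3 / (1 - \<mu>)) ^ degree p * ((\<Sum>i=1..degree p. cmod (u (T - int i))) + ?P)"
    by (rule stable_filter_degree) (use assms in auto)
  also have "\<dots> \<le> (3 / (1 - \<mu>)) ^ m * ((\<Sum>i=1..m. cmod (u (T - int i))) + ?P)"
    using assms by (intro mult_mono power_increasing add_mono sum_mono2)
      (auto simp: field_simps intro!: sum_nonneg add_nonneg_nonneg)
  finally show ?thesis .
qed

lemma map_poly_of_real_smult_pcompose: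
  "coeff (smult c (pcompose (map_poly complex_of_real p) [:0, x:])) i =
    c * (x ^ i * complex_of_real (coeff p i))"
  by (simp add: coeff_pcompose_linear coeff_map_poly)

text \<open>The substitution \<open>u t \<mapsto> r\<^sup>-\<^sup>t u t\<close> moves the zeros of \<open>p\<close> from the disk of radius \<open>r\<close> to the unit
  disk.\<close>

lemma weighted_filter:
  fixes p :: "real poly" and u :: "int \<Rightarrow> real"
  assumes r: "0 \<le> \<mu>" "\<mu> < r"
    and deg: "degree p \<le> m" and p0: "coeff p 0 \<noteq> 0"
    and zeros: "\<And>z. z \<noteq> 0 \<Longrightarrow> poly (map_poly complex_of_real p) (inverse z) = 0 \<Longrightarrow> cmod z \<le> \<mu>"
  shows "(\<Sum>t\<in>{T..K}. r powi (-t) * \<bar>u t\<bar>) \<le> (3 / (1 - \<mu> / r)) ^ m *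
    ((\<Sum>i=1..m. r powi (-(T - int i)) * \<bar>u (T - int i)\<bar>) +
      (\<Sum>t\<in>{T..K}. r powi (-t) * \<bar>lag_op p u t\<bar>) / \<bar>coeff p 0\<bar>)"
proof -
  have l0: "0 < r" using r by simp
  \<comment> \<open>The normalization of the constant term is what produces the division by
    \<open>\<bar>coeff p 0\<bar>\<close> in the bound. The passage to complex numbers only serves to
    have roots: all coefficients of \<open>P\<close> are real.\<close>
  define P where "P = smult (inverse (complex_of_real (coeff p 0)))
    (pcompose (map_poly complex_of_real p) [:0, inverse (complex_of_real r):])"
  define v where "v t = complex_of_real (r powi (-t) * u t)" for t
  have coeffP: "coeff P i = complex_of_real (inverse (coeff p 0) * (inverse r ^ i * coeff p i))" for i
    unfolding P_def map_poly_of_real_smult_pcompose by (simp add: of_real_inverse)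
  have degP: "degree P \<le> degree p"
    by (rule degree_le) (simp add: coeffP coeff_eq_0)
  have lagP: "lag_op P v t = complex_of_real (inverse (coeff p 0) * (r powi (-t) * lag_op p u t))" for t
  proof -
    have "inverse r ^ i * (r powi (-(t - int i)) * x) = r powi (-t) * x" for i x
      using l0 by (simp add: power_int_diff power_int_minus field_simps)
    then have "inverse r ^ i * coeff p i * (r powi (-(t - int i)) * x) = r powi (-t) * (coeff p i * x)" for i x
      by (metis mult.commute mult.left_commute)
    then show ?thesis
      unfolding lag_op_altdef[OF degP] lag_op_def[of p] v_def coeffP of_real_mult[symmetric] 
        of_real_sum[symmetric]
      by (simp only: sum_distrib_left mult.assoc)
  qed
  have roots: "1 \<le> (\<mu> / r) * cmod z" if "poly P z = 0" for z
  proof -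
    have "poly P 0 = coeff P 0" by (rule poly_0_coeff_0)
    then have "poly P 0 \<noteq> 0" using p0 by (simp add: coeffP)
    then have z0: "z \<noteq> 0" using that by auto
    have "poly (map_poly complex_of_real p) (z * inverse (complex_of_real r)) = 0"
      using that p0 by (simp add: P_def poly_pcompose)
    then have "cmod (inverse (z * inverse (complex_of_real r))) \<le> \<mu>"
      using z0 l0 by (intro zeros) auto
    then show ?thesis
      using l0 z0 by (simp add: norm_mult norm_divide norm_inverse field_simps)
  qed
  have cv: "cmod (v t) = r powi (-t) * \<bar>u t\<bar>" for t
    unfolding v_def norm_of_real using l0 by (simp add: abs_mult)
  have cl: "cmod (lag_op P v t) = (r powi (-t) * \<bar>lag_op p u t\<bar>) / \<bar>coeff p 0\<bar>" for t
    unfolding lagP norm_of_real using l0 by (simp add: abs_mult field_simps)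
  have "(\<Sum>t\<in>{T..K}. cmod (v t)) \<le>
      (3 / (1 - \<mu> / r)) ^ m * ((\<Sum>i=1..m. cmod (v (T - int i))) + (\<Sum>t\<in>{T..K}. cmod (lag_op P v t)))"
    by (rule stable_filter) (use r deg degP p0 roots in \<open>auto simp: coeffP\<close>)
  then show ?thesis
    by (simp only: cv cl sum_divide_distrib)
qed

subsection \<open>The discounted loop inequality\<close>

lemma sum_greaterThanAtMost_int_last:
  fixes f :: "int \<Rightarrow> real"
  assumes "s < k"
  shows "sum f {s<..k} = sum f {s<..k - 1} + f k"
proof -
  have "{s<..k} = insert k {s<..k - 1}" using assms by auto
  then show ?thesis by simp
qed

lemma sum_greaterThanAtMost_int_split:
  fixes f :: "int \<Rightarrow> real"
  assumes "s \<le> j" "j \<le> k"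
  shows "sum f {s<..k} = sum f {s<..j} + sum f {j<..k}"
proof -
  have "{s<..k} = {s<..j} \<union> {j<..k}" using assms by auto
  then show ?thesis by (simp add: sum.union_disjoint)
qed

section \<open>Gronwall inequality and the comparison signal\<close>

text \<open>Replacing \<open>1 + h\<close> by \<open>exp h\<close> turns products of growth factors
  into exponentials of sums. Only window sums of \<open>h\<close> matter afterwards; single values
  may be large.\<close>

lemma discrete_gronwall:
  fixes Z h q :: "int \<Rightarrow> real"
  assumes sk: "s \<le> k"
    and step: "\<And>j. s < j \<Longrightarrow> j \<le> k \<Longrightarrow> Z j \<le> (1 + h j) * Z (j - 1) + q j"
    and h: "\<And>j. 0 \<le> h j" and q: "\<And>j. s < j \<Longrightarrow> 0 \<le> q j" and Zs: "0 \<le> Z s"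
  shows "Z k \<le> exp (sum h {s<..k}) * Z s + (\<Sum>j\<in>{s<..k}. exp (sum h {j<..k}) * q j)"
  using sk step
proof (induction k rule: int_ge_induct)
  case base
  then show ?case by simp
next
  case (step k)
  let ?B = "exp (sum h {s<..k}) * Z s + (\<Sum>j\<in>{s<..k}. exp (sum h {j<..k}) * q j)"
  have IH: "Z k \<le> ?B" using step by simp
  have B0: "0 \<le> ?B" using Zs q by (auto intro!: add_nonneg_nonneg sum_nonneg)
  have split: "sum h {j<..k + 1} = sum h {j<..k} + h (k + 1)" if "j \<le> k" for j
    using sum_greaterThanAtMost_int_last[of j "k + 1" h] that by simp
  have "Z (k + 1) \<le> (1 + h (k + 1)) * Z k + q (k + 1)"
    using step.prems[of "k + 1"] step.hyps by simp
  also have "(1 + h (k + 1)) * Z k \<le> (1 + h (k + 1)) * ?B"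
    using IH h[of "k + 1"] by (intro mult_left_mono) auto
  also have "\<dots> \<le> exp (h (k + 1)) * ?B"
    by (rule mult_right_mono[OF exp_ge_add_one_self B0])
  also have "exp (h (k + 1)) * ?B =
      exp (sum h {s<..k + 1}) * Z s + (\<Sum>j\<in>{s<..k}. exp (sum h {j<..k + 1}) * q j)"
  proof -
    have "(\<Sum>j\<in>{s<..k}. exp (sum h {j<..k + 1}) * q j) =
        (\<Sum>j\<in>{s<..k}. exp (h (k + 1)) * (exp (sum h {j<..k}) * q j))"
      by (rule sum.cong) (simp_all add: split exp_add)
    then show ?thesis
      unfolding split[OF step.hyps(1)]
      by (simp add: exp_add distrib_left sum_distrib_left mult.assoc mult.commute mult.left_commute)
  qed
  finally show ?case
    using sum_greaterThanAtMost_int_last[of s "k + 1" "\<lambda>j. exp (sum h {j<..k + 1}) * q j"] step.hyps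
    by simp
qed

text \<open>The closed form of the solution of \<open>z k = \<gamma> * z (k - 1) + q k\<close> with
  \<open>z s = X\<close>.\<close>

definition exp_conv :: "real \<Rightarrow> real \<Rightarrow> int \<Rightarrow> (int \<Rightarrow> real) \<Rightarrow> int \<Rightarrow> real" where
  "exp_conv \<gamma> X s q k = \<gamma> powi (k - s) * X + (\<Sum>j\<in>{s<..k}. \<gamma> powi (k - j) * q j)"

text \<open>The flow property of that recursion; it lets the bound be restarted at an intermediate
  time without loss.\<close>

lemma exp_conv_split:
  assumes "\<gamma> > 0" "s \<le> j" "j \<le> k"
  shows "exp_conv \<gamma> X s q k = exp_conv \<gamma> (exp_conv \<gamma> X s q j) j q k"
proof -
  have pw: "\<gamma> powi (k - j) * \<gamma> powi (j - i) = \<gamma> powi (k - i)" for i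
    using power_int_add[of \<gamma> "k - j" "j - i"] assms by simp
  then have pw': "\<gamma> powi (k - j) * (\<gamma> powi (j - i) * x) = \<gamma> powi (k - i) * x" for i x
    by (metis mult.assoc)
  show ?thesis
    unfolding exp_conv_def sum_greaterThanAtMost_int_split[OF assms(2,3)]
    by (simp add: distrib_left sum_distrib_left pw')
qed

text \<open>
  The abstract closed loop: \<open>a\<close> is the size of the regressor and \<open>q\<close> that of the exogenous signals,
  both discounted by the decay rate of the inverse plant, \<open>\<nu>\<close> is the size of the parameter updates,
  and \<open>V\<close> is the squared parameter error. If \<open>a (t - d) = 0\<close>, the
  quotient in \<open>V_descent\<close> is the junk value 0, which is right because a zero regressor causes no
  update.
\<close>

locale discounted_loop =
  fixes C Vm :: real and d :: nat and t0 :: int and a q \<nu> V yb :: "int \<Rightarrow> real"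
  assumes C: "1 \<le> C"
    and a_nonneg: "0 \<le> a t" and q_nonneg: "0 \<le> q t" and \<nu>_nonneg: "0 \<le> \<nu> t"
    and V_nonneg: "t0 - 1 \<le> t \<Longrightarrow> 0 \<le> V t" and V_le: "t0 - 1 \<le> t \<Longrightarrow> V t \<le> Vm"
    and a_step: "t0 \<le> t \<Longrightarrow> a t \<le> C * (a (t - 1) + q t)"
    and a_filter: "t0 - 1 \<le> s \<Longrightarrow> s \<le> k \<Longrightarrow>
      a k \<le> C * (a s + (\<Sum>t\<in>{s<..k + int d}. yb t + q t))"
    and yb_le: "t0 + int d \<le> t \<Longrightarrow>
      yb t \<le> a (t - int d) * (\<Sum>i<d. \<nu> (t - int i)) + C * (\<Sum>i\<le>d. q (t - int i))"
    and V_descent: "t0 + int d \<le> t \<Longrightarrow>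
      V t \<le> V (t - 1) - (\<nu> t)\<^sup>2 / 2 + 2 * (C * (\<Sum>i<d. q (t - int i)) / a (t - int d))\<^sup>2"
begin

abbreviation gain :: "int \<Rightarrow> real" where
  "gain t \<equiv> \<Sum>i<d. \<nu> (t - int i)"

text \<open>A crude bound, applied only over at most \<open>3 * d\<close> steps, where the power of
  \<open>C\<close> is a constant.\<close>

lemma a_iterate:
  assumes "t0 - 1 \<le> s"
  shows "a (s + int j) \<le> C ^ j * (a s + sum q {s<..s + int j})"
proof (induction j)
  case (Suc j)
  have "a (s + int (Suc j)) \<le> C * (a (s + int j) + q (s + int (Suc j)))"
    using a_step[of "s + int (Suc j)"] assms by simp
  also have "\<dots> \<le> C * (C ^ j * (a s + sum q {s<..s + int j}) + C ^ j * q (s + int (Suc j)))"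
    using Suc C q_nonneg mult_right_mono[OF one_le_power[OF C, of j] q_nonneg[of "s + int (Suc j)"]]
    by (intro mult_left_mono add_mono) auto
  also have "\<dots> = C ^ Suc j * (a s + sum q {s<..s + int (Suc j)})"
    using sum_greaterThanAtMost_int_last[of s "s + int (Suc j)" q] by (simp add: algebra_simps)
  finally show ?case .
qed simp

text \<open>Inserting \<open>yb_le\<close> into \<open>a_filter\<close> closes the loop: the
  regressor is bounded by its own past, weighted with \<open>gain\<close>. As
  \<open>a_filter\<close> looks \<open>d\<close> outputs ahead, it is applied at
  \<open>t - d\<close>, and \<open>a_iterate\<close> bridges the last \<open>d\<close> steps and the
  first \<open>2 * d\<close>.\<close>

lemma window_bound:
  assumes s: "t0 - 1 \<le> s" and t: "s \<le> t"
  shows "a t \<le> (d + 4) * C ^ (3 * d + 2) *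
    (a s + sum q {s<..t} + (\<Sum>j\<in>{s + 2 * int d<..t}. gain j * a (j - int d)))"
    (is "_ \<le> ?K * (_ + ?Q + ?G)")
proof -
  have Q0: "0 \<le> ?Q" and G0: "0 \<le> ?G"
    by (auto intro!: sum_nonneg mult_nonneg_nonneg q_nonneg \<nu>_nonneg a_nonneg)
  have C0: "0 \<le> C" using C by simp
  show ?thesis
  proof (cases "t < s + 3 * int d")
    case True
    define j where "j = nat (t - s)"
    have j: "t = s + int j" "j \<le> 3 * d" using True t by (auto simp: j_def)
    have "C ^ j \<le> C ^ (3 * d + 2)" using j C by (intro power_increasing) auto
    also have "\<dots> \<le> ?K" using C by simp
    finally have "C ^ j * (a s + ?Q) \<le> ?K * (a s + ?Q + ?G)"
      using Q0 G0 a_nonneg[of s] C by (intro mult_mono) auto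
    then show ?thesis
      using a_iterate[OF s, of j] by (simp add: j)
  next
    case False
    \<comment> \<open>Beyond \<open>s + 2 * d\<close>, the lags in \<open>gain\<close> reach only
      updates after \<open>s + d\<close>, and these are driven by regressors after \<open>s\<close>.
      Exactly there \<open>exp_bound\<close> will have the regressor large.\<close>
    define s' where "s' = s + 2 * int d"
    have s': "s \<le> s'" "s' \<le> t - int d" "t0 - 1 \<le> s'" using False s by (auto simp: s'_def)
    have Qmono: "sum q {u<..v} \<le> ?Q" if "s \<le> u" "v \<le> t" for u v
      by (rule sum_mono2) (use that q_nonneg in auto)
    have as': "a s' \<le> C ^ (2 * d) * (a s + ?Q)"
    proof -
      have "a s' \<le> C ^ (2 * d) * (a s + sum q {s<..s'})"
        using a_iterate[OF s, of "2 * d"] by (simp add: s'_def)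
      also have "\<dots> \<le> C ^ (2 * d) * (a s + ?Q)"
        using Qmono[of s s'] s' C0 by (intro mult_left_mono) auto
      finally show ?thesis .
    qed
    have "sum yb {s'<..t} \<le> (\<Sum>j\<in>{s'<..t}. gain j * a (j - int d) + C * (\<Sum>i\<le>d. q (j - int i)))"
      by (rule sum_mono) (use yb_le s s'_def in \<open>auto simp: mult.commute\<close>)
    also have "\<dots> = ?G + C * (\<Sum>j\<in>{s'<..t}. \<Sum>i\<in>{..d}. q (j - int i))"
      by (simp add: sum.distrib sum_distrib_left s'_def)
    also have "\<dots> \<le> ?G + C * (real (card {..d}) * ?Q)"
      using C0 by (intro add_left_mono mult_left_mono sum_lag_le) (auto simp: s'_def q_nonneg)
    finally have yb: "sum yb {s'<..t} \<le> ?G + C * ((d + 1) * ?Q)" by (simp add: algebra_simps)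
    have "a (t - int d) \<le> C * (a s' + (sum yb {s'<..t} + sum q {s'<..t}))"
      using a_filter[of s' "t - int d"] s' by (simp add: sum.distrib)
    also have "\<dots> \<le> C * (C ^ (2 * d) * (a s + ?Q) + (?G + C * ((d + 1) * ?Q) + ?Q))"
      using as' yb Qmono[of s' t] s' C0 by (intro mult_left_mono add_mono) auto
    finally have atd: "a (t - int d) \<le> \<dots>" .
    have "a t \<le> C ^ d * (a (t - int d) + sum q {t - int d<..t})"
      using a_iterate[of "t - int d" d] s' s by simp
    also have "\<dots> \<le> C ^ d * (C * (C ^ (2 * d) * (a s + ?Q) + (?G + C * ((d + 1) * ?Q) + ?Q)) + ?Q)"
      using atd Qmono[of "t - int d" t] s' C0 by (intro mult_left_mono add_mono) auto
    also have "\<dots> = C ^ (3 * d + 1) * a s + C ^ (3 * d + 1) * ?Q + C ^ (d + 1) * ?G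
        + (d + 1) * (C ^ (d + 2) * ?Q) + C ^ (d + 1) * ?Q + C ^ d * ?Q"
    proof -
      have e1: "C ^ (3 * d + 1) = C ^ d * C * C ^ (2 * d)"
        by (simp flip: power_add power_Suc2)
      have e2: "C ^ (d + 2) = C ^ d * C * C" by (simp add: power_add power2_eq_square)
      show ?thesis unfolding e1 e2 by (simp add: algebra_simps)
    qed
    \<comment> \<open>The exponent \<open>3 * d + 2\<close> dominates all those present, for any
      \<open>d\<close>; the sum of \<open>q\<close> then occurs
      \<open>1 + (d + 1) + 1 + 1 = d + 4\<close> times.\<close>
    also have "\<dots> \<le> C ^ (3 * d + 2) * a s + C ^ (3 * d + 2) * ?Q + C ^ (3 * d + 2) * ?G
        + (d + 1) * (C ^ (3 * d + 2) * ?Q) + C ^ (3 * d + 2) * ?Q + C ^ (3 * d + 2) * ?Q"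
      using C Q0 G0 a_nonneg[of s]
      by (intro add_mono mult_left_mono mult_right_mono power_increasing) auto
    also have "\<dots> \<le> ?K * (a s + ?Q + ?G)"
      using C0 Q0 G0 a_nonneg[of s] by (simp add: algebra_simps)
    finally show ?thesis .
  qed
qed

text \<open>Each squared update is paid for by a drop of \<open>V\<close>, up to a term of order
  \<open>eps\<^sup>2\<close>. Young's inequality with weight \<open>eps\<close> turns this into a
  bound on \<open>\<nu>\<close> itself with slope proportional to \<open>eps\<close>, and the drops
  telescope to at most \<open>Vm\<close>.\<close>

lemma update_sum_le:
  assumes j: "t0 + int d - 1 \<le> j" "j \<le> k" and eps: "0 < eps"
    and small: "\<And>i. j < i \<Longrightarrow> i \<le> k \<Longrightarrow> C * (\<Sum>l<d. q (i - int l)) / a (i - int d) \<le> eps"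
  shows "sum \<nu> {j<..k} \<le> 2 * eps * real_of_int (k - j) + Vm / (2 * eps)"
proof -
  have "\<nu> i \<le> 2 * eps + (V (i - 1) - V i) / (2 * eps)" if i: "i \<in> {j<..k}" for i
  proof -
    let ?e = "C * (\<Sum>l<d. q (i - int l)) / a (i - int d)"
    have "0 \<le> ?e"
      using C by (intro divide_nonneg_nonneg mult_nonneg_nonneg sum_nonneg q_nonneg a_nonneg) auto
    then have "?e\<^sup>2 \<le> eps\<^sup>2" using small i by (intro power_mono) auto
    then have "(\<nu> i)\<^sup>2 \<le> 2 * (V (i - 1) - V i) + 4 * eps\<^sup>2"
      using V_descent[of i] i j by auto
    moreover have "4 * eps * \<nu> i \<le> (\<nu> i)\<^sup>2 + 4 * eps\<^sup>2"
      using zero_le_power2[of "\<nu> i - 2 * eps"] by (simp add: power2_eq_square algebra_simps)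
    ultimately have "4 * eps * \<nu> i \<le> 2 * (V (i - 1) - V i) + 8 * eps\<^sup>2" by simp
    then show ?thesis using eps by (simp add: field_simps power2_eq_square)
  qed
  then have "sum \<nu> {j<..k} \<le> (\<Sum>i\<in>{j<..k}. 2 * eps + (V (i - 1) - V i) / (2 * eps))"
    by (rule sum_mono)
  also have "\<dots> = 2 * eps * real_of_int (k - j) + (\<Sum>i\<in>{j<..k}. V (i - 1) - V i) / (2 * eps)"
    using j by (simp add: sum.distrib sum_divide_distrib)
  also have "(\<Sum>i\<in>{j<..k}. V (i - 1) - V i) = V j - V k"
    using j(2)
  proof (induction k rule: int_ge_induct)
    case (step k)
    then show ?case
      using sum_greaterThanAtMost_int_last[of j "k + 1" "\<lambda>i. V (i - 1) - V i"] by simp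
  qed simp
  also have "(V j - V k) / (2 * eps) \<le> Vm / (2 * eps)"
    using V_nonneg[of k] V_le[of j] j eps by (intro divide_right_mono) auto
  finally show ?thesis by simp
qed

text \<open>Each of the \<open>d\<close> lags shifts the window without changing its length: hence
  the factor \<open>d\<close>, and a hypothesis \<open>small\<close> that also covers earlier
  times.\<close>

lemma gain_sum_le:
  assumes j: "t0 + 2 * int d - 1 \<le> j" "j \<le> k" and eps: "0 < eps"
    and small: "\<And>i. j - int d < i \<Longrightarrow> i \<le> k \<Longrightarrow> C * (\<Sum>l<d. q (i - int l)) / a (i - int d) \<le> eps"
  shows "sum gain {j<..k} \<le> d * (2 * eps * real_of_int (k - j) + Vm / (2 * eps))"
proof -
  have "sum gain {j<..k} = (\<Sum>i<d. \<Sum>t\<in>{j<..k}. \<nu> (t - int i))"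
    by (rule sum.swap)
  also have "\<dots> \<le> (\<Sum>i<d. 2 * eps * real_of_int (k - j) + Vm / (2 * eps))"
  proof (rule sum_mono)
    fix i assume i: "i \<in> {..<d}"
    have "(\<Sum>t\<in>{j<..k}. \<nu> (t - int i)) = sum \<nu> ((\<lambda>t. t - int i) ` {j<..k})"
      by (subst sum.reindex) (auto simp: inj_on_def)
    also have "(\<lambda>t. t - int i) ` {j<..k} = {j - int i<..k - int i}"
      by (auto simp: image_iff intro!: bexI[where x = "_ + int i"])
    also have "sum \<nu> \<dots> \<le> 2 * eps * real_of_int ((k - int i) - (j - int i)) + Vm / (2 * eps)"
      by (rule update_sum_le) (use i j eps small in auto)
    finally show "(\<Sum>t\<in>{j<..k}. \<nu> (t - int i)) \<le> 2 * eps * real_of_int (k - j) + Vm / (2 * eps)"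
      by simp
  qed
  finally show ?thesis by simp
qed

text \<open>The constants are variables with defining equations, so that a caller can fix them
  before any trajectory is given. \<open>eps\<close> makes the slope \<open>2 * K * d * eps\<close>
  equal to \<open>ln \<gamma>\<close>. The first entry of \<open>M\<close> lets the term
  \<open>C * q\<close> in \<open>a_step\<close> be absorbed, the second makes the quotient in
  \<open>V_descent\<close> at most \<open>eps\<close>.\<close>

lemma exp_bound:
  fixes \<gamma> X K eps M :: real
  assumes \<gamma>: "1 < \<gamma>" and d: "1 \<le> d" and init: "a (t0 - 1) \<le> X" and k: "t0 - 1 \<le> k"
    and K: "K = (d + 4) * C ^ (3 * d + 2)" and eps: "eps = ln \<gamma> / (2 * K * d)"
    and M: "M = max (2 * C) (C * d * (2 * C) ^ d / eps)"
  shows "a k \<le> exp (K * d * Vm / (2 * eps)) * K * M * exp_conv \<gamma> X (t0 - 1) q k"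
proof -
  define R where "R = exp_conv \<gamma> X (t0 - 1) q"
  have C0: "0 \<le> C" using C by simp
  have K1: "1 \<le> K"
    unfolding K using mult_mono[of 1 "real (d + 4)" 1 "C ^ (3 * d + 2)"] one_le_power[OF C, of "3 * d + 2"]
    by linarith
  have eps0: "0 < eps" unfolding eps using \<gamma> K1 d by simp
  have M1: "2 * C \<le> M" "C * d * (2 * C) ^ d / eps \<le> M" unfolding M by simp_all
  then have M0: "1 \<le> M" using C by simp
  have X0: "0 \<le> X" using init a_nonneg[of "t0 - 1"] by simp
  have R0: "0 \<le> R i" for i
    unfolding R_def exp_conv_def using \<gamma> X0 q_nonneg by (auto intro!: add_nonneg_nonneg sum_nonneg)
  have qR: "q i \<le> R i" if "t0 \<le> i" for i
  proof -
    have "\<gamma> powi (i - i) * q i \<le> (\<Sum>j\<in>{t0 - 1<..i}. \<gamma> powi (i - j) * q j)"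
      by (rule member_le_sum) (use that \<gamma> q_nonneg in auto)
    also have "\<dots> \<le> R i" unfolding R_def exp_conv_def using \<gamma> X0 by simp
    finally show ?thesis by simp
  qed
  \<comment> \<open>The time \<open>t0 - 1\<close> qualifies, because there the comparison signal is
    \<open>X\<close> and \<open>M \<ge> 1\<close>; so a last such time exists.\<close>
  obtain s where s: "t0 - 1 \<le> s" "s \<le> k" "a s \<le> M * R s"
    and big: "\<And>i. s < i \<Longrightarrow> i \<le> k \<Longrightarrow> M * R i < a i"
  proof -
    define I where "I = {i\<in>{t0 - 1..k}. a i \<le> M * R i}"
    have "X \<le> M * X" using mult_right_mono[OF M0 X0] by simp
    then have "t0 - 1 \<in> I" using k init by (simp add: I_def R_def exp_conv_def)
    moreover have fin: "finite I"
      by (rule finite_subset[of _ "{t0 - 1..k}"]) (auto simp: I_def)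
    ultimately have "Max I \<in> I" by (intro Max_in) auto
    moreover have "M * R i < a i" if "Max I < i" "i \<le> k" for i
    proof -
      have "i \<notin> I" using Max_ge[OF fin, of i] that by auto
      then show ?thesis using that \<open>Max I \<in> I\<close> by (auto simp: I_def)
    qed
    ultimately show ?thesis by (intro that[of "Max I"]) (auto simp: I_def)
  qed
  \<comment> \<open>After \<open>s\<close> the term \<open>C * q\<close> is at most half of
    \<open>a\<close>, so the regressor grows at most by the factor \<open>2 * C\<close> per step.
    This is needed because \<open>big\<close> compares signals at equal times, whereas the quotient
    in \<open>V_descent\<close> has the regressor at the earlier time \<open>i - d\<close>.\<close>
  have a_lag: "a i \<le> (2 * C) ^ l * a (i - int l)" if "s \<le> i - int l" "i \<le> k" for i l
    using that
  proof (induction l)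
    case (Suc l)
    let ?j = "i - int l"
    have j: "s < ?j" "?j \<le> k" "t0 \<le> ?j" using Suc.prems s by auto
    have "2 * C * q ?j \<le> M * R ?j"
      using M1 qR[OF j(3)] q_nonneg[of ?j] R0 M0 by (intro mult_mono) auto
    also have "\<dots> \<le> a ?j" using big j by force
    finally have "a ?j \<le> 2 * C * a (?j - 1)"
      using a_step[OF j(3)] by (simp add: algebra_simps)
    have "a i \<le> (2 * C) ^ l * a ?j" using Suc by simp
    also have "\<dots> \<le> (2 * C) ^ l * (2 * C * a (?j - 1))"
      using \<open>a ?j \<le> _\<close> C0 by (intro mult_left_mono) auto
    finally show ?case by (simp add: algebra_simps)
  qed simp
  have small: "C * (\<Sum>l<d. q (i - int l)) / a (i - int d) \<le> eps" if i: "s + int d < i" "i \<le> k" for i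
  proof -
    have apos: "0 < a (i - int d)"
      using big[of "i - int d"] i R0[of "i - int d"] M0 by (smt (verit) mult_nonneg_nonneg of_nat_0_le_iff)
    have "q (i - int l) \<le> (2 * C) ^ d * a (i - int d) / M" if l: "l < d" for l
    proof -
      have "M * q (i - int l) \<le> M * R (i - int l)"
        using qR[of "i - int l"] i l s M0 by (intro mult_left_mono) auto
      also have "\<dots> \<le> a (i - int l)" using big[of "i - int l"] i l by force
      also have "\<dots> \<le> (2 * C) ^ (d - l) * a (i - int d)"
        using a_lag[of "i - int l" "d - l"] i l by (simp add: of_nat_diff)
      also have "\<dots> \<le> (2 * C) ^ d * a (i - int d)"
        using C apos by (intro mult_right_mono power_increasing) auto
      finally show ?thesis using M0 by (simp add: field_simps)
    qed
    then have "(\<Sum>l<d. q (i - int l)) \<le> (\<Sum>l<d. (2 * C) ^ d * a (i - int d) / M)"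
      by (intro sum_mono) auto
    then have "C * (\<Sum>l<d. q (i - int l)) \<le> C * (d * ((2 * C) ^ d * a (i - int d) / M))"
      using C0 by (intro mult_left_mono) auto
    also have "\<dots> = (C * d * (2 * C) ^ d / M) * a (i - int d)" by simp
    also have "\<dots> \<le> eps * a (i - int d)"
      using M1(2) M0 eps0 apos by (intro mult_right_mono) (auto simp: field_simps)
    finally show ?thesis using apos by (simp add: field_simps)
  qed
  \<comment> \<open>Gronwall is applied to this majorant and not to \<open>a\<close>:
    \<open>Z\<close> is monotone, so the delayed regressor \<open>a (j - d)\<close> in its increment
    is at most \<open>Z (j - 1)\<close>, which turns a delayed inequality into a one-step
    recursion.\<close>
  define Z where "Z t = K * (a s + sum q {s<..t} + (\<Sum>j\<in>{s + 2 * int d<..t}. gain j * a (j - int d)))" for t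
  define h where "h j = (if s + 2 * int d < j then K * gain j else 0)" for j
  have gain0: "0 \<le> gain j" for j by (intro sum_nonneg \<nu>_nonneg)
  have aZ: "a t \<le> Z t" if "s \<le> t" for t
    unfolding Z_def K by (rule window_bound[OF s(1) that])
  have Zmono: "Z i \<le> Z j" if "i \<le> j" for i j
    unfolding Z_def using K1 that q_nonneg gain0 a_nonneg
    by (intro mult_left_mono add_mono order_refl sum_mono2) auto
  have h0: "0 \<le> h j" for j using gain0 K1 by (auto simp: h_def)
  have Zstep: "Z j \<le> (1 + h j) * Z (j - 1) + K * q j" if j: "s < j" for j
  proof (cases "s + 2 * int d < j")
    case True
    have "a (j - int d) \<le> Z (j - 1)"
      using aZ[of "j - int d"] Zmono[of "j - int d" "j - 1"] True d by simp
    then have "K * gain j * a (j - int d) \<le> K * gain j * Z (j - 1)"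
      using gain0 K1 by (intro mult_left_mono) auto
    moreover have "Z j = Z (j - 1) + K * q j + K * gain j * a (j - int d)"
      unfolding Z_def sum_greaterThanAtMost_int_last[OF j] sum_greaterThanAtMost_int_last[OF True]
      by (simp add: algebra_simps)
    ultimately show ?thesis using True by (simp add: h_def algebra_simps)
  next
    case False
    then show ?thesis
      unfolding Z_def sum_greaterThanAtMost_int_last[OF j] by (simp add: h_def algebra_simps)
  qed
  let ?c0 = "K * d * Vm / (2 * eps)"
  have Vm0: "0 \<le> Vm" using V_nonneg[of t0] V_le[of t0] by simp
  have h_exp: "exp (sum h {i<..k}) \<le> exp ?c0 * \<gamma> powi (k - i)" if i: "s \<le> i" "i \<le> k" for i
  proof -
    \<comment> \<open>Up to \<open>s + 2 * d\<close> the rate \<open>h\<close> vanishes, so the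
      window can be cut to the part where \<open>small\<close> is available for all lags in
      \<open>gain\<close>.\<close>
    define i' where "i' = max i (s + 2 * int d)"
    have "sum h {i<..k} \<le> ?c0 + ln \<gamma> * real_of_int (k - i)"
    proof (cases "i' \<le> k")
      case True
      have "sum h {i<..k} = (\<Sum>j\<in>{i'<..k}. K * gain j)"
        by (rule sum.mono_neutral_cong_right) (auto simp: i'_def h_def)
      also have "\<dots> = K * sum gain {i'<..k}" by (simp add: sum_distrib_left)
      also have "\<dots> \<le> K * (d * (2 * eps * real_of_int (k - i') + Vm / (2 * eps)))"
        using K1 eps0 True s by (intro mult_left_mono gain_sum_le small) (auto simp: i'_def)
      also have "\<dots> = ln \<gamma> * real_of_int (k - i') + ?c0"
        using K1 d by (simp add: eps field_simps)
      also have "\<dots> \<le> ?c0 + ln \<gamma> * real_of_int (k - i)"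
        using \<gamma> by (simp add: i'_def)
      finally show ?thesis .
    next
      case False
      then have "sum h {i<..k} = 0"
        by (intro sum.neutral) (auto simp: i'_def h_def)
      then show ?thesis using K1 d Vm0 eps0 \<gamma> i by simp
    qed
    then have "exp (sum h {i<..k}) \<le> exp (?c0 + ln \<gamma> * real_of_int (k - i))" by simp
    also have "\<dots> = exp ?c0 * \<gamma> powi (k - i)"
      using \<gamma> i powr_real_of_int'[of \<gamma> "k - i"] by (simp add: exp_add powr_def mult.commute)
    finally show ?thesis .
  qed
  have "a k \<le> Z k" using aZ s by simp
  also have "\<dots> \<le> exp (sum h {s<..k}) * Z s + (\<Sum>j\<in>{s<..k}. exp (sum h {j<..k}) * (K * q j))"
    using s Zstep h0 K1 q_nonneg a_nonneg
    by (intro discrete_gronwall) (auto simp: Z_def intro!: mult_nonneg_nonneg)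
  also have "\<dots> \<le> exp ?c0 * \<gamma> powi (k - s) * (K * M * R s)
      + (\<Sum>j\<in>{s<..k}. exp ?c0 * \<gamma> powi (k - j) * (K * M * q j))"
  proof (intro add_mono sum_mono)
    have "Z s \<le> K * M * R s" using s K1 by (simp add: Z_def)
    then show "exp (sum h {s<..k}) * Z s \<le> exp ?c0 * \<gamma> powi (k - s) * (K * M * R s)"
      using h_exp[of s] s \<gamma> K1 a_nonneg by (intro mult_mono) (auto simp: Z_def)
  next
    fix j assume j: "j \<in> {s<..k}"
    have "K * q j \<le> K * M * q j"
      using mult_right_mono[OF M0, of "K * q j"] K1 q_nonneg[of j] by (simp add: mult_ac)
    then show "exp (sum h {j<..k}) * (K * q j) \<le> exp ?c0 * \<gamma> powi (k - j) * (K * M * q j)"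
      using h_exp[of j] j \<gamma> M0 K1 q_nonneg by (intro mult_mono) auto
  qed
  also have "\<dots> = exp ?c0 * K * M * exp_conv \<gamma> (R s) s q k"
    unfolding exp_conv_def distrib_left sum_distrib_left by (simp add: mult_ac)
  also have "exp_conv \<gamma> (R s) s q k = exp_conv \<gamma> X (t0 - 1) q k"
    unfolding R_def using exp_conv_split[of \<gamma> "t0 - 1" s k X q] \<gamma> s by simp
  finally show ?thesis .
qed

end

subsection \<open>The predictor form\<close>

lemma abs_coord_le_norm: "\<bar>coord v i\<bar> \<le> norm v"
  unfolding coord_def by (rule component_le_norm_cart)

lemma bij_betw_from_nat_into_UNIV:
  "bij_betw (from_nat_into UNIV) {..<CARD('k::finite)} (UNIV :: 'k set)"
  by (rule bij_betw_from_nat_into_finite) simp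

lemma inner_coord:
  fixes v w :: "real ^ 'k::finite"
  shows "v \<bullet> w = (\<Sum>i<CARD('k). coord v i * coord w i)"
  using sum.reindex_bij_betw[OF bij_betw_from_nat_into_UNIV, of "\<lambda>i. vec_nth v i * vec_nth w i"]
  by (simp add: inner_vec_def coord_def)

lemma norm_le_sum_coord:
  fixes v :: "real ^ 'k::finite"
  shows "norm v \<le> (\<Sum>i<CARD('k). \<bar>coord v i\<bar>)"
  using sum.reindex_bij_betw[OF bij_betw_from_nat_into_UNIV, of "\<lambda>i. \<bar>vec_nth v i\<bar>"] norm_le_l1_cart[of v]
  by (simp add: coord_def)

lemma continuous_on_coord: "continuous_on A (\<lambda>v. coord v i)"
  unfolding coord_def by (intro continuous_intros)

lemma sum_lessThan_add:
  fixes f :: "nat \<Rightarrow> 'a::comm_monoid_add"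
  shows "sum f {..<n + N} = sum f {..<n} + (\<Sum>i<N. f (n + i))"
  by (induction N) (simp_all add: add_ac)

lemma coord_regressor:
  assumes "CARD('p::finite) = n + N"
  shows "i < n \<Longrightarrow> coord (regressor n y u t :: real ^ 'p) i = y (t - int i)"
    and "i < N \<Longrightarrow> coord (regressor n y u t :: real ^ 'p) (n + i) = u (t - int i)"
  using assms by (simp_all add: regressor_def coord_mkvec)

lemma inner_regressor:
  fixes \<theta> :: "real ^ 'p::finite"
  assumes "CARD('p) = n + N"
  shows "regressor n y u t \<bullet> \<theta> =
    (\<Sum>i<n. coord \<theta> i * y (t - int i)) + (\<Sum>i<N. coord \<theta> (n + i) * u (t - int i))"
  unfolding inner_coord assms sum_lessThan_add using coord_regressor[OF assms, of _ y u t]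
  by (simp add: mult.commute)

lemma norm_regressor_le:
  assumes "CARD('p::finite) = n + N"
  shows "norm (regressor n y u t :: real ^ 'p) \<le>
    (\<Sum>i<n. \<bar>y (t - int i)\<bar>) + (\<Sum>i<N. \<bar>u (t - int i)\<bar>)"
  using norm_le_sum_coord[of "regressor n y u t :: real ^ 'p"] coord_regressor[OF assms, of _ y u t]
  unfolding assms sum_lessThan_add by simp

lemma abs_le_norm_regressor:
  assumes "CARD('p::finite) = n + N"
  shows "s \<le> t \<Longrightarrow> t < s + int n \<Longrightarrow> \<bar>y s\<bar> \<le> norm (regressor n y u t :: real ^ 'p)"
    and "s \<le> t \<Longrightarrow> t < s + int N \<Longrightarrow> \<bar>u s\<bar> \<le> norm (regressor n y u t :: real ^ 'p)"
  using abs_coord_le_norm[of "regressor n y u t :: real ^ 'p" "nat (t - s)"]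
    abs_coord_le_norm[of "regressor n y u t :: real ^ 'p" "n + nat (t - s)"]
    coord_regressor[OF assms, of "nat (t - s)" y u t]
  by auto

section \<open>Plant polynomials as filters and the Bezout identity\<close>

lemma coeff_A_poly: "coeff (A_poly n \<theta>) i = (if i \<le> n then a_coef \<theta> i else 0)"
  by (simp add: A_poly_def coeff_sum)

lemma coeff_B_poly: "coeff (B_poly n m \<theta>) i = (if i \<le> m then b_coef n \<theta> i else 0)"
  by (simp add: B_poly_def coeff_sum)

lemma degree_A_poly: "degree (A_poly n \<theta>) \<le> n"
  by (rule degree_le) (simp add: coeff_A_poly)

lemma degree_B_poly: "degree (B_poly n m \<theta>) \<le> m"
  by (rule degree_le) (simp add: coeff_B_poly)

lemma lag_op_A_poly: "lag_op (A_poly n \<theta>) y t = (\<Sum>i\<le>n. a_coef \<theta> i * y (t - int i))"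
  by (simp add: lag_op_altdef[OF degree_A_poly] coeff_A_poly)

lemma lag_op_B_poly: "lag_op (B_poly n m \<theta>) u t = (\<Sum>i\<le>m. b_coef n \<theta> i * u (t - int i))"
  by (simp add: lag_op_altdef[OF degree_B_poly] coeff_B_poly)

lemma lag_op_lessThan:
  assumes "\<And>i. N \<le> i \<Longrightarrow> coeff p i = 0"
  shows "lag_op p u t = (\<Sum>i<N. coeff p i * u (t - int i))"
  unfolding lag_op_def
  by (rule sum.mono_neutral_cong)
    (use assms in \<open>auto simp: coeff_eq_0 not_le not_less\<close>)

text \<open>\<open>A\<close> has constant term 1, hence is a unit among power series, and the Bezout
  identity can be divided by it.\<close>

lemma bezout_imp_predictor_polys:
  assumes "\<And>i. d \<le> i \<Longrightarrow> coeff F i = 0" "\<And>i. n \<le> i \<Longrightarrow> coeff G i = 0"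
    and bez: "F * A_poly n \<theta> + monom 1 d * G = 1"
  shows "predictor_polys n d \<theta> F G"
proof -
  let ?A = "fps_of_poly (A_poly n \<theta>)"
  have A0: "fps_nth ?A 0 \<noteq> 0" by (simp add: coeff_A_poly a_coef_def)
  have "fps_of_poly F * ?A + fps_X ^ d * fps_of_poly G = 1"
    using arg_cong[OF bez, of fps_of_poly]
    by (simp add: fps_of_poly_add fps_of_poly_mult fps_of_poly_monom')
  then have "1 * inverse ?A = (fps_of_poly F * ?A + fps_X ^ d * fps_of_poly G) * inverse ?A"
    by simp
  also have "\<dots> = fps_of_poly F * (inverse ?A * ?A) + fps_X ^ d * (fps_of_poly G * inverse ?A)"
    by (simp add: algebra_simps)
  finally show ?thesis
    using assms(1,2) unfolding predictor_polys_def fps_divide_unit[OF A0]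
    by (simp add: inverse_mult_eq_1[OF A0])
qed

text \<open>\<open>F\<close> is the series \<open>1 / A\<close> truncated below order
  \<open>d\<close>, so \<open>1 - F * A\<close> is divisible by the \<open>d\<close>-th power of the
  indeterminate, and \<open>G\<close> is the quotient. The Bezout identity is delivered as well,
  since polynomials, unlike power series, act on signals through \<open>lag_op\<close>.\<close>

lemma ex_predictor_polys:
  fixes \<theta> :: "real ^ 'q::finite"
  assumes d: "1 \<le> d"
  obtains F G where "predictor_polys n d \<theta> F G" "F * A_poly n \<theta> + monom 1 d * G = 1"
proof -
  let ?A = "A_poly n \<theta>"
  define H where "H = inverse (fps_of_poly ?A)"
  define F where "F = (\<Sum>i<d. monom (fps_nth H i) i)"
  define G where "G = poly_shift d (1 - F * ?A)"
  have coeffF: "coeff F i = (if i < d then fps_nth H i else 0)" for i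
    by (simp add: F_def coeff_sum)
  have HA: "H * fps_of_poly ?A = 1"
    unfolding H_def by (rule inverse_mult_eq_1) (simp add: coeff_A_poly a_coef_def)
  have low: "coeff (1 - F * ?A) k = 0" if "k < d" for k
  proof -
    have "coeff (F * ?A) k = fps_nth (H * fps_of_poly ?A) k"
      unfolding coeff_mult fps_mult_nth atMost_atLeast0
      by (rule sum.cong) (use that in \<open>auto simp: coeffF\<close>)
    then show ?thesis by (simp add: HA coeff_1)
  qed
  have "degree F \<le> d - 1" by (rule degree_le) (auto simp: coeffF)
  then have "degree (F * ?A) \<le> d - 1 + n"
    using degree_mult_le[of F ?A] degree_A_poly[of n \<theta>] by linarith
  then have high: "coeff G i = 0" if "n \<le> i" for i
    using that d by (simp add: G_def coeff_poly_shift coeff_eq_0)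
  have "monom 1 d * G = 1 - F * ?A"
    by (rule poly_eqI) (use low in \<open>auto simp: coeff_monom_mult G_def coeff_poly_shift\<close>)
  then have bez: "F * ?A + monom 1 d * G = 1" by simp
  then show ?thesis
    by (intro that[of F G] bezout_imp_predictor_polys) (auto simp: coeffF high)
qed

text \<open>Below order \<open>d\<close> the Bezout identity is a recursion for the coefficients of
  \<open>F\<close>. Its majorant with every coefficient of \<open>A\<close> replaced by
  \<open>P\<close> is solved by powers of \<open>1 + P\<close>. The bound is uniform over the
  parameter set.\<close>

lemma abs_coeff_predictor_le:
  assumes bez: "F * A_poly n \<theta> + monom 1 d * G = 1" and P: "norm \<theta> \<le> P"
  shows "i < d \<Longrightarrow> \<bar>coeff F i\<bar> \<le> (1 + P) ^ i"
proof (induction i rule: less_induct)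
  case (less i)
  let ?A = "A_poly n \<theta>"
  have P0: "0 \<le> P" using P norm_ge_zero order_trans by blast
  have "coeff (F * ?A) i = coeff 1 i"
    using arg_cong[OF bez, of "\<lambda>p. coeff p i"] less.prems by (simp add: coeff_monom_mult)
  moreover have "coeff (F * ?A) i = coeff F i + (\<Sum>j<i. coeff F j * coeff ?A (i - j))"
    unfolding coeff_mult lessThan_Suc_atMost[symmetric] by (simp add: coeff_A_poly a_coef_def)
  ultimately have eq: "coeff F i = coeff 1 i - (\<Sum>j<i. coeff F j * coeff ?A (i - j))" by simp
  have "\<bar>\<Sum>j<i. coeff F j * coeff ?A (i - j)\<bar> \<le> (\<Sum>j<i. (1 + P) ^ j * P)"
  proof (intro order_trans[OF sum_abs] sum_mono)
    fix j assume j: "j \<in> {..<i}"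
    have "\<bar>coeff ?A (i - j)\<bar> \<le> P"
      using order_trans[OF abs_coord_le_norm P] j P0 by (simp add: coeff_A_poly a_coef_def)
    then show "\<bar>coeff F j * coeff ?A (i - j)\<bar> \<le> (1 + P) ^ j * P"
      unfolding abs_mult using less j P0 by (intro mult_mono) auto
  qed
  also have "\<dots> = (1 + P) ^ i - 1"
    by (induction i) (simp_all add: algebra_simps)
  finally have sum_le: "\<bar>\<Sum>j<i. coeff F j * coeff ?A (i - j)\<bar> \<le> (1 + P) ^ i - 1" .
  show ?case
  proof (cases "i = 0")
    case True
    then show ?thesis using eq by simp
  next
    case False
    then show ?thesis using eq sum_le by (simp add: coeff_1)
  qed
qed

text \<open>The Bezout identity, applied to \<open>y\<close> as an identity of filters. The
  disturbance \<open>wbar\<close> is indexed by the time of the output it enters, that is,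
  \<open>d\<close> steps later than the predictor form in terms of \<open>y(t+d)\<close>
  does.\<close>

lemma predictor_form:
  fixes \<theta>ab :: "real ^ 'q::finite"
  assumes d: "1 \<le> d" and card_p: "CARD('p::finite) = n + m + d" and P: "norm \<theta>ab \<le> P"
    and plant: "\<And>t. t0 \<le> t \<Longrightarrow>
      lag_op (A_poly n \<theta>ab) y t = lag_op (B_poly n m \<theta>ab) u (t - int d) + w t"
  obtains \<theta> :: "real ^ 'p" and wbar where "\<theta> \<in> S_alphabeta n m d {\<theta>ab}"
    "\<And>t. t0 - 1 + int d \<le> t \<Longrightarrow> y t = regressor n y u (t - int d) \<bullet> \<theta> + wbar t"
    "\<And>t. \<bar>wbar t\<bar> \<le> (1 + P) ^ d * (\<Sum>i<d. \<bar>w (t - int i)\<bar>)"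
proof -
  let ?A = "A_poly n \<theta>ab" and ?B = "B_poly n m \<theta>ab"
  obtain F G where FG: "predictor_polys n d \<theta>ab F G" and bez: "F * ?A + monom 1 d * G = 1"
    using ex_predictor_polys[OF d] by blast
  have F0: "coeff F i = 0" if "d \<le> i" for i using FG that by (simp add: predictor_polys_def)
  have lagF: "lag_op F v t = (\<Sum>i<d. coeff F i * v (t - int i))" for v t
    by (rule lag_op_lessThan) (rule F0)
  have G0: "coeff G i = 0" if "n \<le> i" for i using FG that by (simp add: predictor_polys_def)
  define \<theta> :: "real ^ 'p" where
    "\<theta> = mkvec (\<lambda>i. if i < n then coeff G i else coeff (F * ?B) (i - n))"
  have card': "CARD('p) = n + (m + d)" using card_p by simp
  have deg_F: "degree F \<le> d - 1" by (rule degree_le) (use F0 in auto)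
  then have deg_FB: "degree (F * ?B) \<le> d - 1 + m"
    using degree_mult_le[of F ?B] degree_B_poly[of n m \<theta>ab] by linarith
  have FB0: "coeff (F * ?B) i = 0" if "m + d \<le> i" for i
    using that deg_FB d by (intro coeff_eq_0) simp
  have reg: "regressor n y u t \<bullet> \<theta> = lag_op G y t + lag_op (F * ?B) u t" for t
    unfolding inner_regressor[OF card'] using card'
    by (simp add: lag_op_lessThan[OF G0] lag_op_lessThan[OF FB0] \<theta>_def coord_mkvec)
  have P0: "0 \<le> P" using P norm_ge_zero order_trans by blast
  show ?thesis
  proof (rule that[of \<theta> "lag_op F w"])
    show "\<theta> \<in> S_alphabeta n m d {\<theta>ab}"
      unfolding S_alphabeta_def \<theta>_def using FG by blast
  next
    fix t assume t: "t0 - 1 + int d \<le> t"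
    have "y t = lag_op (F * ?A + monom 1 d * G) y t"
      unfolding bez by (simp add: one_pCons lag_op_pCons)
    also have "\<dots> = lag_op F (lag_op ?A y) t + lag_op G y (t - int d)"
      by (simp add: lag_op_add lag_op_mult lag_op_monom)
    \<comment> \<open>\<open>F\<close> has \<open>d\<close> coefficients, so only the plant
      equations at times \<open>t - d + 1\<close> to \<open>t\<close> are used; with
      \<open>t \<ge> t0 - 1 + d\<close> all of them hold.\<close>
    also have "lag_op F (lag_op ?A y) t = lag_op F (\<lambda>s. lag_op ?B u (s - int d) + w s) t"
      unfolding lagF
      by (rule sum.cong) (use t plant in auto)
    also have "\<dots> = lag_op (F * ?B) u (t - int d) + lag_op F w t"
      unfolding lag_op_mult by (simp add: lag_op_def sum.distrib algebra_simps)
    finally show "y t = regressor n y u (t - int d) \<bullet> \<theta> + lag_op F w t"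
      by (simp add: reg)
  next
    fix t
    have "\<bar>lag_op F w t\<bar> \<le> (\<Sum>i<d. \<bar>coeff F i * w (t - int i)\<bar>)"
      unfolding lagF by (rule sum_abs)
    also have "\<dots> \<le> (\<Sum>i<d. (1 + P) ^ d * \<bar>w (t - int i)\<bar>)"
    proof (rule sum_mono)
      fix i assume i: "i \<in> {..<d}"
      have "\<bar>coeff F i\<bar> \<le> (1 + P) ^ i" using abs_coeff_predictor_le[OF bez P] i by simp
      also have "\<dots> \<le> (1 + P) ^ d" using i P0 by (intro power_increasing) auto
      finally show "\<bar>coeff F i * w (t - int i)\<bar> \<le> (1 + P) ^ d * \<bar>w (t - int i)\<bar>"
        unfolding abs_mult by (rule mult_right_mono) simp
    qed
    finally show "\<bar>lag_op F w t\<bar> \<le> (1 + P) ^ d * (\<Sum>i<d. \<bar>w (t - int i)\<bar>)"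
      by (simp add: sum_distrib_left)
  qed
qed

subsection \<open>The adaptive closed loop\<close>

text \<open>The factor with \<open>P\<close> comes from the plant equation for the new output;
  \<open>\<sigma> / \<beta>min\<close> and \<open>1 / \<beta>min\<close> come from solving the
  control law for the new input.\<close>

definition step_gain :: "nat \<Rightarrow> nat \<Rightarrow> nat \<Rightarrow> real \<Rightarrow> real \<Rightarrow> real \<Rightarrow> real" where
  "step_gain n m d P \<sigma> \<beta>min =
    real (n + m + d) * (1 + \<sigma> / \<beta>min) * (real (n + m + 1) * P + 1) + 1 / \<beta>min"

text \<open>The powers of \<open>1 / L\<close> pay for moving weights between the times that meet in
  one regressor or one plant equation. The power with exponent \<open>m\<close> is the gain of the
  inverse of \<open>B\<close> after its zeros are scaled by \<open>1 / L\<close>.\<close>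

definition filter_gain :: "nat \<Rightarrow> nat \<Rightarrow> nat \<Rightarrow> real \<Rightarrow> real \<Rightarrow> real \<Rightarrow> real \<Rightarrow> real" where
  "filter_gain n m d P bmin \<mu> L = (1 / L) ^ (n + m + d) * real (n + m + d) *
    (1 + (3 / (1 - \<mu> / L)) ^ m * (real m + real (n + 1) * ((1 + P) * (1 / L) ^ n * real (n + 1)) / bmin))"

locale adaptive_loop =
  fixes n m d :: nat and \<theta>ab :: "real ^ 'q::finite" and \<delta> :: ereal and S :: "(real ^ 'p::finite) set"
    and t0 :: int and \<theta>0 :: "real ^ 'p" and ystar w y u :: "int \<Rightarrow> real"
    and \<theta>hat :: "int \<Rightarrow> real ^ 'p" and P \<beta>min :: real and \<phi> :: "int \<Rightarrow> real ^ 'p"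
  assumes d: "1 \<le> d" and card_p: "CARD('p) = n + m + d"
    and S_compact: "compact S" and S_convex: "convex S" and S_contains: "S_alphabeta n m d {\<theta>ab} \<subseteq> S"
    and \<beta>min: "0 < \<beta>min" and \<beta>min_le: "\<And>\<theta>. \<theta> \<in> S \<Longrightarrow> \<beta>min \<le> \<bar>coord \<theta> n\<bar>"
    and P: "norm \<theta>ab \<le> P" and delta: "0 < \<delta>" and \<theta>0: "\<theta>0 \<in> S"
    and loop: "closed_loop n m d \<theta>ab \<delta> S t0 \<theta>0 ystar w y u \<theta>hat"
    and \<phi>: "\<phi> = regressor n y u"
begin

abbreviation f :: "int \<Rightarrow> real" where "f t \<equiv> norm (\<phi> t)"
abbreviation e :: "int \<Rightarrow> real" where "e t \<equiv> pred_error n d y u \<theta>hat t"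
abbreviation r :: "int \<Rightarrow> real" where "r t \<equiv> \<bar>ystar (t + int d)\<bar> + \<bar>w t\<bar>"
abbreviation \<sigma> :: real where "\<sigma> \<equiv> set_norm S"

text \<open>The length of the parameter step before projection. Where the regressor vanishes, the
  quotient is 0, as is the step.\<close>

definition upd :: "int \<Rightarrow> real" where
  "upd t = rho \<delta> S (\<phi> (t - int d)) (e t) * \<bar>e t\<bar> / f (t - int d)"

lemma card_p': "CARD('p) = n + (m + d)"
  using card_p by simp

lemmas inner_\<phi> = inner_regressor[OF card_p', of y u, folded \<phi>]
  and norm_\<phi>_le = norm_regressor_le[OF card_p', of y u, folded \<phi>]
  and abs_le_\<phi> = abs_le_norm_regressor[OF card_p', where y = y and u = u, folded \<phi>]

lemma norm_le_\<sigma>: "\<theta> \<in> S \<Longrightarrow> norm \<theta> \<le> \<sigma>"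
  unfolding set_norm_def
  using compact_imp_bounded[OF S_compact]
  by (intro cSup_upper) (auto simp: bounded_iff bdd_above_def)

lemma \<sigma>_nonneg: "0 \<le> \<sigma>"
  using norm_le_\<sigma>[OF \<theta>0] norm_ge_zero order_trans by blast

lemma P_nonneg: "0 \<le> P"
  using P norm_ge_zero order_trans by blast

lemma plant: "t0 \<le> t \<Longrightarrow>
    lag_op (A_poly n \<theta>ab) y t = lag_op (B_poly n m \<theta>ab) u (t - int d) + w t"
  using loop by (simp add: closed_loop_def lag_op_A_poly lag_op_B_poly)

lemma \<theta>hat_update: "t0 \<le> t \<Longrightarrow> \<theta>hat t = closest_point S (theta_check n d \<delta> S y u \<theta>hat t)"
  using loop unfolding closed_loop_def by (auto dest!: spec[of _ "t - 1"])

lemma control: "t0 \<le> t \<Longrightarrow> ystar (t + int d) = \<theta>hat t \<bullet> \<phi> t"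
  using loop unfolding closed_loop_def \<phi> by auto

lemma \<theta>hat_in_S: "t0 - 1 \<le> t \<Longrightarrow> \<theta>hat t \<in> S"
proof (cases "t = t0 - 1")
  case True
  then show ?thesis using loop \<theta>0 by (simp add: closed_loop_def)
next
  case False
  moreover assume "t0 - 1 \<le> t"
  ultimately show ?thesis
    using \<theta>hat_update[of t] closest_point_in_set[OF compact_imp_closed[OF S_compact]] \<theta>0 by auto
qed

text \<open>Projection onto a convex set is nonexpansive and fixes the points of \<open>S\<close>,
  so it never moves the estimate away from a candidate parameter.\<close>

lemma \<theta>hat_contract:
  assumes "t0 \<le> t" "\<theta> \<in> S"
  shows "norm (\<theta>hat t - \<theta>) \<le> norm (theta_check n d \<delta> S y u \<theta>hat t - \<theta>)"
  using closest_point_lipschitz[of S "theta_check n d \<delta> S y u \<theta>hat t" \<theta>] S_compact S_convex assms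
  by (auto simp: \<theta>hat_update closest_point_self compact_imp_closed dist_norm)

lemma theta_check_eq: "theta_check n d \<delta> S y u \<theta>hat t = \<theta>hat (t - 1) +
    (rho \<delta> S (\<phi> (t - int d)) (e t) * e t / (f (t - int d))\<^sup>2) *\<^sub>R \<phi> (t - int d)"
  by (simp add: theta_check_def Let_def \<phi>)

lemma rho_cases:
  obtains (off) "rho \<delta> S (\<phi> (t - int d)) (e t) = 0" "upd t = 0"
  | (on) "rho \<delta> S (\<phi> (t - int d)) (e t) = 1" "0 < f (t - int d)" "upd t = \<bar>e t\<bar> / f (t - int d)"
proof (cases "rho \<delta> S (\<phi> (t - int d)) (e t) = 0")
  case False
  then have rho: "rho \<delta> S (\<phi> (t - int d)) (e t) = 1" by (simp add: rho_def split: if_splits)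
  \<comment> \<open>Even for \<open>\<delta> = \<infinity>\<close> a zero regressor switches the
    update off: the threshold is then \<open>\<infinity> * 0 = 0\<close>, and the comparison is
    strict.\<close>
  have "f (t - int d) \<noteq> 0"
  proof
    assume "f (t - int d) = 0"
    then have "rho \<delta> S (\<phi> (t - int d)) (e t) = 0" by (simp add: rho_def flip: zero_ereal_def)
    with rho show False by simp
  qed
  then show ?thesis using on rho by (simp add: upd_def)
qed (simp add: off upd_def)

lemma upd_nonneg: "0 \<le> upd t"
  by (cases t rule: rho_cases) auto

lemma \<theta>hat_step:
  assumes "t0 \<le> t"
  shows "norm (\<theta>hat t - \<theta>hat (t - 1)) \<le> upd t"
proof -
  have "norm (\<theta>hat t - \<theta>hat (t - 1)) \<le> norm (theta_check n d \<delta> S y u \<theta>hat t - \<theta>hat (t - 1))"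
    using assms \<theta>hat_in_S[of "t - 1"] by (intro \<theta>hat_contract) auto
  also have "\<dots> \<le> upd t"
    unfolding theta_check_eq
    by (cases t rule: rho_cases) (auto simp: power2_eq_square)
  finally show ?thesis .
qed

lemma \<theta>hat_drift:
  assumes "t0 + int l \<le> t + 1"
  shows "norm (\<theta>hat t - \<theta>hat (t - int l)) \<le> (\<Sum>i<l. upd (t - int i))"
  using assms
proof (induction l)
  case (Suc l)
  have "norm (\<theta>hat t - \<theta>hat (t - int (Suc l))) \<le>
      norm (\<theta>hat t - \<theta>hat (t - int l)) + norm (\<theta>hat (t - int l) - \<theta>hat (t - int l - 1))"
    by (rule order_trans[OF _ norm_triangle_ineq]) (simp add: algebra_simps)
  also have "\<dots> \<le> (\<Sum>i<l. upd (t - int i)) + upd (t - int l)"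
    using Suc by (intro add_mono \<theta>hat_step) auto
  finally show ?case by simp
qed simp

section \<open>Growth of the regressor\<close>

text \<open>Only \<open>y t\<close> and \<open>u t\<close> are new in \<open>\<phi> t\<close>. As
  \<open>d \<ge> 1\<close>, the plant equation gives \<open>y t\<close> from entries of
  \<open>\<phi> (t - 1)\<close>, and the control law gives \<open>u t\<close> after division by a
  coordinate that is bounded away from 0 on \<open>S\<close>.\<close>

lemma regressor_step:
  assumes t: "t0 \<le> t"
  shows "f t \<le> step_gain n m d P \<sigma> \<beta>min * (f (t - 1) + r t)"
proof -
  define N where "N = real (n + m + d)"
  let ?f = "f (t - 1)" and ?y = "\<bar>y t\<bar>"
  have N0: "0 \<le> N" by (simp add: N_def)
  have y_old: "\<bar>y (t - int i)\<bar> \<le> ?f" if "1 \<le> i" "i \<le> n" for i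
    using that by (intro abs_le_\<phi>(1)) auto
  have u_old: "\<bar>u (t - int i)\<bar> \<le> ?f" if "1 \<le> i" "i \<le> m + d" for i
    using that by (intro abs_le_\<phi>(2)) auto
  have y_lag: "\<bar>y (t - int i)\<bar> \<le> ?y + ?f" if "i < n" for i
    using y_old[of i] that by (cases "i = 0") auto
  have coef_le: "\<bar>coord \<theta>ab i\<bar> \<le> P" for i
    using abs_coord_le_norm P by (rule order_trans)
  have "y t = (\<Sum>i\<le>m. b_coef n \<theta>ab i * u (t - int d - int i)) + w t
      - (\<Sum>i=1..n. a_coef \<theta>ab i * y (t - int i))"
  proof -
    have "(\<Sum>i\<le>n. a_coef \<theta>ab i * y (t - int i)) = y t + (\<Sum>i=1..n. a_coef \<theta>ab i * y (t - int i))"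
      by (simp add: atMost_atLeast0 sum.atLeast_Suc_atMost a_coef_def)
    then show ?thesis using plant[OF t] by (simp add: lag_op_A_poly lag_op_B_poly)
  qed
  also have "\<bar>\<dots>\<bar> \<le> (\<Sum>i\<le>m. P * ?f) + \<bar>w t\<bar> + (\<Sum>i=1..n. P * ?f)"
  proof -
    have "\<bar>\<Sum>i\<le>m. b_coef n \<theta>ab i * u (t - int d - int i)\<bar> \<le> (\<Sum>i\<le>m. P * ?f)"
    proof (intro order_trans[OF sum_abs] sum_mono)
      fix i assume "i \<in> {..m}"
      then show "\<bar>b_coef n \<theta>ab i * u (t - int d - int i)\<bar> \<le> P * ?f"
        unfolding abs_mult b_coef_def using coef_le u_old[of "d + i"] d P_nonneg
        by (intro mult_mono) (auto simp: algebra_simps)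
    qed
    moreover have "\<bar>\<Sum>i=1..n. a_coef \<theta>ab i * y (t - int i)\<bar> \<le> (\<Sum>i=1..n. P * ?f)"
    proof (intro order_trans[OF sum_abs] sum_mono)
      fix i assume "i \<in> {1..n}"
      then show "\<bar>a_coef \<theta>ab i * y (t - int i)\<bar> \<le> P * ?f"
        unfolding abs_mult a_coef_def using coef_le y_old[of i] P_nonneg
        by (intro mult_mono) auto
    qed
    ultimately show ?thesis by linarith
  qed
  also have "\<dots> = real (n + m + 1) * P * ?f + \<bar>w t\<bar>" by (simp add: algebra_simps)
  finally have y_le: "?y \<le> real (n + m + 1) * P * ?f + \<bar>w t\<bar>" .
  have S: "\<theta>hat t \<in> S" using t by (intro \<theta>hat_in_S) simp
  have coord_le: "\<bar>coord (\<theta>hat t) i\<bar> \<le> \<sigma>" for i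
    using abs_coord_le_norm norm_le_\<sigma>[OF S] by (rule order_trans)
  obtain c where c: "m + d = Suc c" using d by (cases "m + d") auto
  have "ystar (t + int d) = (\<Sum>i<n. coord (\<theta>hat t) i * y (t - int i))
      + (coord (\<theta>hat t) n * u t + (\<Sum>i<c. coord (\<theta>hat t) (n + Suc i) * u (t - int (Suc i))))"
    using control[OF t] inner_\<phi>[of t "\<theta>hat t"]
    by (simp add: inner_commute c sum.lessThan_Suc_shift del: sum.lessThan_Suc)
  then have "coord (\<theta>hat t) n * u t = ystar (t + int d) - (\<Sum>i<n. coord (\<theta>hat t) i * y (t - int i))
      - (\<Sum>i<c. coord (\<theta>hat t) (n + Suc i) * u (t - int (Suc i)))" by simp
  then have "\<bar>coord (\<theta>hat t) n * u t\<bar> \<le> \<bar>ystar (t + int d)\<bar> + \<bar>\<Sum>i<n. coord (\<theta>hat t) i * y (t - int i)\<bar>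
      + \<bar>\<Sum>i<c. coord (\<theta>hat t) (n + Suc i) * u (t - int (Suc i))\<bar>" by linarith
  also have "\<dots> \<le> \<bar>ystar (t + int d)\<bar> + (\<Sum>i<n. \<sigma> * (?y + ?f)) + (\<Sum>i<c. \<sigma> * (?y + ?f))"
  proof (intro add_mono order_refl order_trans[OF sum_abs] sum_mono)
    fix i assume "i \<in> {..<n}"
    then show "\<bar>coord (\<theta>hat t) i * y (t - int i)\<bar> \<le> \<sigma> * (?y + ?f)"
      unfolding abs_mult using coord_le y_lag \<sigma>_nonneg by (intro mult_mono) auto
  next
    fix i assume "i \<in> {..<c}"
    then have "\<bar>u (t - int (Suc i))\<bar> \<le> ?y + ?f" using u_old[of "Suc i"] c by simp
    then show "\<bar>coord (\<theta>hat t) (n + Suc i) * u (t - int (Suc i))\<bar> \<le> \<sigma> * (?y + ?f)"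
      unfolding abs_mult using coord_le \<sigma>_nonneg by (intro mult_mono) auto
  qed
  also have "\<dots> = \<bar>ystar (t + int d)\<bar> + real (n + c) * (\<sigma> * (?y + ?f))" by (simp add: algebra_simps)
  also have "\<dots> \<le> \<bar>ystar (t + int d)\<bar> + N * (\<sigma> * (?y + ?f))"
    using \<sigma>_nonneg c by (intro add_mono mult_right_mono) (auto simp: N_def)
  finally have "\<bar>coord (\<theta>hat t) n\<bar> * \<bar>u t\<bar> \<le> \<bar>ystar (t + int d)\<bar> + N * (\<sigma> * (?y + ?f))"
    by (simp add: abs_mult)
  moreover have "\<beta>min * \<bar>u t\<bar> \<le> \<bar>coord (\<theta>hat t) n\<bar> * \<bar>u t\<bar>"
    using \<beta>min_le[OF S] by (intro mult_right_mono) auto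
  ultimately have u_le: "\<bar>u t\<bar> \<le> (\<bar>ystar (t + int d)\<bar> + N * (\<sigma> * (?y + ?f))) / \<beta>min"
    using \<beta>min by (simp add: field_simps)
  have "f t \<le> (\<Sum>i<n. \<bar>y (t - int i)\<bar>) + (\<Sum>i<m + d. \<bar>u (t - int i)\<bar>)"
    by (rule norm_\<phi>_le)
  also have "\<dots> = (\<Sum>i<n. \<bar>y (t - int i)\<bar>) + (\<bar>u t\<bar> + (\<Sum>i<c. \<bar>u (t - int (Suc i))\<bar>))"
    by (simp add: c sum.lessThan_Suc_shift del: sum.lessThan_Suc)
  also have "\<dots> \<le> (\<Sum>i<n. ?y + ?f) + (\<bar>u t\<bar> + (\<Sum>i<c. ?y + ?f))"
  proof (intro add_mono order_refl sum_mono)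
    fix i assume "i \<in> {..<c}"
    then show "\<bar>u (t - int (Suc i))\<bar> \<le> ?y + ?f" using u_old[of "Suc i"] c by simp
  qed (use y_lag in auto)
  also have "\<dots> = real (n + c) * (?y + ?f) + \<bar>u t\<bar>" by (simp add: algebra_simps)
  also have "\<dots> \<le> N * (?y + ?f) + (\<bar>ystar (t + int d)\<bar> + N * (\<sigma> * (?y + ?f))) / \<beta>min"
    using c u_le by (intro add_mono mult_right_mono) (auto simp: N_def)
  also have "\<dots> = N * (1 + \<sigma> / \<beta>min) * (?y + ?f) + \<bar>ystar (t + int d)\<bar> / \<beta>min"
    using \<beta>min by (simp add: field_simps)
  also have "\<dots> \<le> N * (1 + \<sigma> / \<beta>min) * ((real (n + m + 1) * P + 1) * (?f + r t)) + (?f + r t) / \<beta>min"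
  proof (intro add_mono mult_left_mono divide_right_mono)
    have "?y + ?f \<le> (real (n + m + 1) * P + 1) * ?f + 1 * \<bar>w t\<bar>"
      using y_le by (simp add: algebra_simps)
    also have "\<dots> \<le> (real (n + m + 1) * P + 1) * ?f + (real (n + m + 1) * P + 1) * r t"
      using P_nonneg by (intro add_left_mono mult_mono) auto
    finally show "?y + ?f \<le> (real (n + m + 1) * P + 1) * (?f + r t)" by (simp add: algebra_simps)
  qed (use N0 \<sigma>_nonneg \<beta>min in auto)
  finally show ?thesis
    unfolding step_gain_def N_def[symmetric] distrib_right[of _ "1 / \<beta>min"] by (simp add: mult.assoc)
qed

text \<open>The plant is read backwards: \<open>B\<close> applied to the input at time
  \<open>t\<close> equals \<open>A\<close> applied to the output at \<open>t + d\<close>, minus the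
  disturbance there. Inverting the stable \<open>B\<close> recovers the inputs, which is why outputs
  up to \<open>k + d\<close> occur.\<close>

lemma regressor_filter:
  fixes L \<mu> bmin :: real
  assumes s: "t0 - 1 \<le> s" "s \<le> k" and L: "0 \<le> \<mu>" "\<mu> < L" "L \<le> 1"
    and b: "0 < bmin" "bmin \<le> \<bar>b_coef n \<theta>ab 0\<bar>"
    and zeros: "\<And>z. z \<in> B_zeros n m \<theta>ab \<Longrightarrow> cmod z \<le> \<mu>"
  shows "L powi (-k) * f k \<le> filter_gain n m d P bmin \<mu> L *
    (L powi (-s) * f s + (\<Sum>t\<in>{s<..k + int d}. L powi (-t) * \<bar>y t\<bar> + L powi (-t) * r t))"
proof -
  define W where "W t = L powi (-t)" for t
  define H where "H = (3 / (1 - \<mu> / L)) ^ m"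
  define D where "D = (1 + P) * (1 / L) ^ n * (n + 1)"
  let ?E = "W s * f s"
  let ?Y = "\<Sum>t\<in>{s<..k + int d}. W t * \<bar>y t\<bar>" and ?R = "\<Sum>t\<in>{s<..k + int d}. W t * r t"
  let ?U = "\<Sum>t\<in>{s + 1..k}. W t * \<bar>u t\<bar>"
  have L0: "0 < L" using L by simp
  have W0: "0 < W t" for t using L0 by (simp add: W_def)
  have W_shift: "W t = (1 / L) ^ i * W (t - int i)" for t i
    using L0 by (simp add: W_def power_int_diff power_int_minus field_simps)
  have iL1: "1 \<le> 1 / L" using L L0 by simp
  have W_le: "W t \<le> (1 / L) ^ j * W (t - int i)" if "i \<le> j" for t i j
    unfolding W_shift[of t i] using that W0[of "t - int i"] iL1
    by (intro mult_right_mono power_increasing) auto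
  have W_mono: "W i \<le> W j" if "i \<le> j" for i j
    unfolding W_def using that L L0 by (intro power_int_decreasing) auto
  have H0: "0 \<le> H" unfolding H_def using L L0 by (simp add: field_simps)
  have D1: "1 \<le> D"
  proof -
    have "1 * 1 * 1 \<le> (1 + P) * (1 / L) ^ n * (real n + 1)"
      using P_nonneg iL1 L0 by (intro mult_mono one_le_power) auto
    then show ?thesis by (simp add: D_def add.commute)
  qed
  have E0: "0 \<le> ?E" and Y0: "0 \<le> ?Y" and R0: "0 \<le> ?R" and U0: "0 \<le> ?U"
    using W0 by (auto intro!: sum_nonneg mult_nonneg_nonneg add_nonneg_nonneg simp: less_imp_le)
  have y_init: "W t * \<bar>y t\<bar> \<le> ?E" if "t \<le> s" "s < t + int n" for t
    using that W_mono[of t s] W0 abs_le_\<phi>(1)[of t s]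
    by (intro mult_mono) (auto simp: less_imp_le)
  have u_init: "W t * \<bar>u t\<bar> \<le> ?E" if "t \<le> s" "s < t + int (m + d)" for t
    using that W_mono[of t s] W0 abs_le_\<phi>(2)[of t s]
    by (intro mult_mono) (auto simp: less_imp_le)

  have lagB: "W t * \<bar>lag_op (B_poly n m \<theta>ab) u t\<bar> \<le>
      (\<Sum>i\<le>n. (1 + P) * (1 / L) ^ n * (W (t + int d - int i) * \<bar>y (t + int d - int i)\<bar>)) + W (t + int d) * r (t + int d)"
    if t: "s < t" for t
  proof -
    let ?t = "t + int d"
    have "lag_op (B_poly n m \<theta>ab) u t = (\<Sum>i\<le>n. a_coef \<theta>ab i * y (?t - int i)) - w ?t"
      using plant[of ?t] t s d by (simp add: lag_op_A_poly)
    then have "\<bar>lag_op (B_poly n m \<theta>ab) u t\<bar> \<le> (\<Sum>i\<le>n. \<bar>a_coef \<theta>ab i * y (?t - int i)\<bar>) + \<bar>w ?t\<bar>"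
      using sum_abs[of "\<lambda>i. a_coef \<theta>ab i * y (?t - int i)" "{..n}"] by linarith
    then have "W t * \<bar>lag_op (B_poly n m \<theta>ab) u t\<bar> \<le>
        W ?t * ((\<Sum>i\<le>n. \<bar>a_coef \<theta>ab i * y (?t - int i)\<bar>) + \<bar>w ?t\<bar>)"
      using W_mono[of t ?t] W0 by (intro mult_mono) (auto simp: less_imp_le)
    also have "\<dots> = (\<Sum>i\<le>n. W ?t * (\<bar>a_coef \<theta>ab i\<bar> * \<bar>y (?t - int i)\<bar>)) + W ?t * \<bar>w ?t\<bar>"
      by (simp add: distrib_left sum_distrib_left abs_mult)
    also have "\<dots> \<le> (\<Sum>i\<le>n. ((1 / L) ^ n * W (?t - int i)) * ((1 + P) * \<bar>y (?t - int i)\<bar>)) + W ?t * r ?t"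
    proof (intro add_mono sum_mono mult_mono W_le)
      fix i
      show "\<bar>a_coef \<theta>ab i\<bar> \<le> 1 + P"
        using order_trans[OF abs_coord_le_norm P, of "i - 1"] P_nonneg by (auto simp: a_coef_def)
    qed (use W0 L0 P_nonneg in \<open>auto simp: less_imp_le\<close>)
    finally show ?thesis by (simp add: mult_ac)
  qed
  have "(\<Sum>t\<in>{s + 1..k}. W t * \<bar>lag_op (B_poly n m \<theta>ab) u t\<bar>) \<le>
    (\<Sum>t\<in>{s + 1..k}. (\<Sum>i\<le>n. (1 + P) * (1 / L) ^ n * (W (t + int d - int i) * \<bar>y (t + int d - int i)\<bar>)) + W (t + int d) * r (t + int d))"
    by (intro sum_mono lagB) auto
  also have "\<dots> = (\<Sum>t\<in>(\<lambda>t. t + int d) ` {s + 1..k}.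
      (\<Sum>i\<le>n. (1 + P) * (1 / L) ^ n * (W (t - int i) * \<bar>y (t - int i)\<bar>)) + W t * r t)"
    by (subst sum.reindex) (auto simp: inj_on_def)
  also have "\<dots> = (1 + P) * (1 / L) ^ n * (\<Sum>t\<in>(\<lambda>t. t + int d) ` {s + 1..k}. \<Sum>i\<in>{..n}. W (t - int i) * \<bar>y (t - int i)\<bar>)
      + (\<Sum>t\<in>(\<lambda>t. t + int d) ` {s + 1..k}. W t * r t)"
    by (simp add: sum.distrib sum_distrib_left)
  also have "\<dots> \<le> (1 + P) * (1 / L) ^ n * (real (card {..n}) * (\<Sum>t\<in>{s - int n<..k + int d}. W t * \<bar>y t\<bar>)) + ?R"
    using P_nonneg L0 W0 by (intro add_mono mult_left_mono sum_lag_le sum_mono2) (auto simp: less_imp_le)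
  \<comment> \<open>The outputs up to \<open>s\<close> that the lags of \<open>A\<close> can reach
    are among the \<open>n\<close> output entries of \<open>\<phi> s\<close>. In the same way, the
    initial inputs of the inverse filter started at \<open>s + 1\<close> are entries of
    \<open>\<phi> s\<close>.\<close>
  also have "(\<Sum>t\<in>{s - int n<..k + int d}. W t * \<bar>y t\<bar>) = (\<Sum>t\<in>{s - int n<..s}. W t * \<bar>y t\<bar>) + ?Y"
    using s by (intro sum_greaterThanAtMost_int_split) auto
  also have "(\<Sum>t\<in>{s - int n<..s}. W t * \<bar>y t\<bar>) \<le> (\<Sum>t\<in>{s - int n<..s}. ?E)"
    by (intro sum_mono y_init) auto
  finally have B_sum: "(\<Sum>t\<in>{s + 1..k}. W t * \<bar>lag_op (B_poly n m \<theta>ab) u t\<bar>) \<le> D * (n * ?E + ?Y) + ?R"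
    using P_nonneg L0 by (simp add: D_def mult_ac)
  have "?U \<le> H * ((\<Sum>i=1..m. W (s + 1 - int i) * \<bar>u (s + 1 - int i)\<bar>)
      + (\<Sum>t\<in>{s + 1..k}. W t * \<bar>lag_op (B_poly n m \<theta>ab) u t\<bar>) / \<bar>b_coef n \<theta>ab 0\<bar>)"
    using weighted_filter[OF L(1,2) degree_B_poly[of n m \<theta>ab], where T = "s + 1" and K = k and u = u] b zeros
    by (simp add: H_def W_def coeff_B_poly B_zeros_def)
  also have "\<dots> \<le> H * ((\<Sum>i=1..m. ?E) + (D * (n * ?E + ?Y) + ?R) / bmin)"
    using H0 B_sum b W0 d D1 E0 Y0 R0
    by (intro mult_left_mono add_mono sum_mono frac_le u_init add_nonneg_nonneg mult_nonneg_nonneg)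
      (auto intro!: sum_nonneg simp: less_imp_le)
  also have "\<dots> \<le> H * ((m + (n + 1) * D / bmin) * (?E + ?Y + ?R))"
  proof (rule mult_left_mono[OF _ H0])
    have "D * (n * ?E + ?Y) + ?R \<le> (n + 1) * D * (?E + ?Y + ?R)"
    proof -
      have "?R \<le> D * ?R" using mult_right_mono[OF D1 R0] by simp
      moreover have "0 \<le> D * ?E" "0 \<le> n * (D * ?Y)" "0 \<le> n * (D * ?R)"
        using D1 E0 Y0 R0 by auto
      ultimately show ?thesis by (simp add: algebra_simps)
    qed
    then have "(D * (n * ?E + ?Y) + ?R) / bmin \<le> (n + 1) * D * (?E + ?Y + ?R) / bmin"
      using b by (intro divide_right_mono) auto
    moreover have "m * ?E \<le> m * (?E + ?Y + ?R)" using Y0 R0 by (intro mult_left_mono) auto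
    ultimately show "(\<Sum>i=1..m. ?E) + (D * (n * ?E + ?Y) + ?R) / bmin \<le>
        (m + (n + 1) * D / bmin) * (?E + ?Y + ?R)"
      by (simp add: distrib_right)
  qed
  finally have U: "?U \<le> H * (m + (n + 1) * D / bmin) * (?E + ?Y + ?R)" by (simp add: mult.assoc)

  have y_all: "W t * \<bar>y t\<bar> \<le> ?E + ?Y + ?U" if "t \<le> k" "k < t + int n" for t
  proof (cases "t \<le> s")
    case True
    then show ?thesis using y_init[of t] that s Y0 U0 by simp
  next
    case False
    then have "W t * \<bar>y t\<bar> \<le> ?Y"
      using that W0 by (intro member_le_sum) (auto simp: less_imp_le)
    then show ?thesis using E0 U0 by simp
  qed
  have u_all: "W t * \<bar>u t\<bar> \<le> ?E + ?Y + ?U" if "t \<le> k" "k < t + int (m + d)" for t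
  proof (cases "t \<le> s")
    case True
    then show ?thesis using u_init[of t] that s Y0 U0 by simp
  next
    case False
    then have "W t * \<bar>u t\<bar> \<le> ?U"
      using that W0 by (intro member_le_sum) (auto simp: less_imp_le)
    then show ?thesis using E0 Y0 by simp
  qed
  let ?N = "n + m + d"
  have "W k * f k \<le> W k * ((\<Sum>i<n. \<bar>y (k - int i)\<bar>) + (\<Sum>i<m + d. \<bar>u (k - int i)\<bar>))"
    using W0 by (intro mult_left_mono norm_\<phi>_le) (auto simp: less_imp_le)
  also have "\<dots> = (\<Sum>i<n. W k * \<bar>y (k - int i)\<bar>) + (\<Sum>i<m + d. W k * \<bar>u (k - int i)\<bar>)"
    by (simp add: distrib_left sum_distrib_left)
  also have "\<dots> \<le> (\<Sum>i<n. (1 / L) ^ ?N * (?E + ?Y + ?U)) + (\<Sum>i<m + d. (1 / L) ^ ?N * (?E + ?Y + ?U))"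
  proof (intro add_mono sum_mono)
    fix i assume i: "i \<in> {..<n}"
    have "W k * \<bar>y (k - int i)\<bar> \<le> (1 / L) ^ ?N * W (k - int i) * \<bar>y (k - int i)\<bar>"
      using i by (intro mult_right_mono W_le) auto
    also have "\<dots> \<le> (1 / L) ^ ?N * (?E + ?Y + ?U)"
      unfolding mult.assoc using i L0 by (intro mult_left_mono y_all) auto
    finally show "W k * \<bar>y (k - int i)\<bar> \<le> \<dots>" .
  next
    fix i assume i: "i \<in> {..<m + d}"
    have "W k * \<bar>u (k - int i)\<bar> \<le> (1 / L) ^ ?N * W (k - int i) * \<bar>u (k - int i)\<bar>"
      using i by (intro mult_right_mono W_le) auto
    also have "\<dots> \<le> (1 / L) ^ ?N * (?E + ?Y + ?U)"
      unfolding mult.assoc using i L0 by (intro mult_left_mono u_all) auto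
    finally show "W k * \<bar>u (k - int i)\<bar> \<le> \<dots>" .
  qed
  also have "\<dots> = (1 / L) ^ ?N * ?N * (?E + ?Y + ?U)" by (simp add: algebra_simps)
  also have "\<dots> \<le> (1 / L) ^ ?N * ?N * ((1 + H * (m + (n + 1) * D / bmin)) * (?E + ?Y + ?R))"
    using U R0 L0 by (intro mult_left_mono) (auto simp: distrib_right)
  finally show ?thesis
    unfolding filter_gain_def W_def[symmetric] H_def[symmetric] D_def[symmetric]
    by (simp only: sum.distrib mult.assoc add.assoc)
qed

section \<open>Estimation and tracking errors\<close>

lemma error_eq: "e t = y t - \<phi> (t - int d) \<bullet> \<theta>hat (t - 1)"
  by (simp add: pred_error_def \<phi>)

context
  fixes \<theta> :: "real ^ 'p" and wbar :: "int \<Rightarrow> real"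
  assumes \<theta>: "\<theta> \<in> S"
    and pred: "\<And>t. t0 - 1 + int d \<le> t \<Longrightarrow> y t = \<phi> (t - int d) \<bullet> \<theta> + wbar t"
begin

lemma error_eq': "t0 - 1 + int d \<le> t \<Longrightarrow> e t = wbar t - \<phi> (t - int d) \<bullet> (\<theta>hat (t - 1) - \<theta>)"
  by (simp add: error_eq pred inner_diff_right)

lemma param_error_le: "t0 - 1 \<le> t \<Longrightarrow> norm (\<theta>hat t - \<theta>) \<le> 2 * \<sigma>"
  using norm_triangle_ineq4[of "\<theta>hat t" \<theta>] norm_le_\<sigma>[OF \<theta>] norm_le_\<sigma>[OF \<theta>hat_in_S, of t] by simp

text \<open>The usual computation for a normalized gradient step: since the inner product of
  regressor and parameter error is \<open>wbar - e\<close>, the square changes by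
  \<open>2 * e * wbar - e\<^sup>2\<close> over the squared regressor norm, and Young's inequality
  gives up half of \<open>e\<^sup>2\<close> to remove the mixed term.\<close>

lemma param_error_descent:
  assumes t: "t0 - 1 + int d \<le> t"
  shows "(norm (\<theta>hat t - \<theta>))\<^sup>2 \<le>
    (norm (\<theta>hat (t - 1) - \<theta>))\<^sup>2 - (upd t)\<^sup>2 / 2 + 2 * (wbar t / f (t - int d))\<^sup>2"
proof -
  let ?x = "\<theta>hat (t - 1) - \<theta>" and ?\<phi> = "\<phi> (t - int d)"
  have "(norm (\<theta>hat t - \<theta>))\<^sup>2 \<le> (norm (theta_check n d \<delta> S y u \<theta>hat t - \<theta>))\<^sup>2"
    using t d \<theta> by (intro power_mono \<theta>hat_contract) auto
  also have "\<dots> \<le> (norm ?x)\<^sup>2 - (upd t)\<^sup>2 / 2 + 2 * (wbar t / norm ?\<phi>)\<^sup>2"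
  proof (cases t rule: rho_cases)
    case off
    then show ?thesis by (simp add: theta_check_eq)
  next
    case on
    let ?c = "e t / (norm ?\<phi>)\<^sup>2"
    have norm_sq: "(norm (x + c *\<^sub>R v))\<^sup>2 = (norm x)\<^sup>2 + 2 * c * (v \<bullet> x) + c\<^sup>2 * (norm v)\<^sup>2"
      for x v :: "real ^ 'p" and c
      unfolding power2_norm_eq_inner
      by (simp add: inner_add_left inner_add_right inner_commute power2_eq_square)
    have "theta_check n d \<delta> S y u \<theta>hat t - \<theta> = ?x + ?c *\<^sub>R ?\<phi>"
      by (simp add: theta_check_eq on)
    then have "(norm (theta_check n d \<delta> S y u \<theta>hat t - \<theta>))\<^sup>2 =
        (norm ?x)\<^sup>2 + 2 * ?c * (?\<phi> \<bullet> ?x) + ?c\<^sup>2 * (norm ?\<phi>)\<^sup>2"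
      by (simp only: norm_sq)
    also have "?\<phi> \<bullet> ?x = wbar t - e t" using error_eq'[OF t] by simp
    also have "?c\<^sup>2 * (norm ?\<phi>)\<^sup>2 = (e t)\<^sup>2 / (norm ?\<phi>)\<^sup>2"
      using on by (simp add: power2_eq_square)
    finally have "(norm (theta_check n d \<delta> S y u \<theta>hat t - \<theta>))\<^sup>2 =
        (norm ?x)\<^sup>2 + (2 * e t * wbar t - (e t)\<^sup>2) / (norm ?\<phi>)\<^sup>2"
      by (simp add: power2_eq_square diff_divide_distrib add_divide_distrib algebra_simps)
    also have "\<dots> \<le> (norm ?x)\<^sup>2 + (2 * (wbar t)\<^sup>2 - (e t)\<^sup>2 / 2) / (norm ?\<phi>)\<^sup>2"
      using zero_le_power2[of "e t - 2 * wbar t"]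
      by (intro add_left_mono divide_right_mono) (auto simp: power2_eq_square algebra_simps)
    also have "\<dots> = (norm ?x)\<^sup>2 - (upd t)\<^sup>2 / 2 + 2 * (wbar t / norm ?\<phi>)\<^sup>2"
      by (simp add: on power_divide diff_divide_distrib)
    finally show ?thesis .
  qed
  finally show ?thesis .
qed

text \<open>For \<open>\<delta> = \<infinity>\<close> the junk value \<open>real_of_ereal \<infinity> = 0\<close> turns the factor below into the correct value 1.\<close>

lemma pred_error_le:
  assumes t: "t0 - 1 + int d \<le> t"
  shows "\<bar>e t\<bar> \<le> f (t - int d) * upd t + (1 + 2 * \<sigma> / real_of_ereal \<delta>) * \<bar>wbar t\<bar>"
proof (cases t rule: rho_cases)
  case off
  let ?f = "f (t - int d)"
  have "\<bar>\<phi> (t - int d) \<bullet> (\<theta>hat (t - 1) - \<theta>)\<bar> \<le> ?f * (2 * \<sigma>)"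
    using param_error_le[of "t - 1"] t d
    by (intro order_trans[OF Cauchy_Schwarz_ineq2] mult_left_mono) auto
  then have e_le: "\<bar>e t\<bar> \<le> \<bar>wbar t\<bar> + 2 * \<sigma> * ?f"
    using error_eq'[OF t] by (simp add: algebra_simps)
  \<comment> \<open>A rejected update means that the error exceeds what a parameter error of at most
    \<open>2 * \<sigma>\<close> can explain. The margin \<open>\<delta>\<close> bounds the regressor
    by the disturbance, and for \<open>\<delta> = \<infinity>\<close> the regressor must vanish.
    Either way the error is a multiple of \<open>wbar\<close>.\<close>
  from off(1) have large: "(ereal (2 * \<sigma>) + \<delta>) * ereal ?f \<le> ereal \<bar>e t\<bar>"
    by (auto simp: rho_def not_less split: if_splits)
  have "\<bar>e t\<bar> \<le> (1 + 2 * \<sigma> / real_of_ereal \<delta>) * \<bar>wbar t\<bar>"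
  proof (cases \<delta>)
    case (real x)
    then have x: "0 < x" using delta by simp
    have "(2 * \<sigma> + x) * ?f \<le> \<bar>e t\<bar>" using large real by simp
    then have "x * ?f \<le> \<bar>wbar t\<bar>" using e_le by (simp add: algebra_simps)
    then have "2 * \<sigma> / x * (x * ?f) \<le> 2 * \<sigma> / x * \<bar>wbar t\<bar>"
      using x \<sigma>_nonneg by (intro mult_left_mono) auto
    then show ?thesis using e_le x real by (simp add: algebra_simps)
  next
    case PInf
    then have "?f = 0" using large by (cases "?f = 0") auto
    then show ?thesis using e_le PInf by simp
  next
    case MInf
    then show ?thesis using delta by simp
  qed
  then show ?thesis by (simp add: off)
next
  case on
  have "0 \<le> real_of_ereal \<delta>" using delta by (simp add: real_of_ereal_pos)
  then have "0 \<le> (1 + 2 * \<sigma> / real_of_ereal \<delta>) * \<bar>wbar t\<bar>"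
    using \<sigma>_nonneg by (intro mult_nonneg_nonneg add_nonneg_nonneg) auto
  then show ?thesis using on by simp
qed

text \<open>The reference is the prediction made with the estimate at \<open>t - d\<close>, whereas
  \<open>e t\<close> uses the one at \<open>t - 1\<close>. The \<open>d - 1\<close> parameter steps
  between them, together with the step at \<open>t\<close> that bounds \<open>e t\<close>, are the
  last \<open>d\<close> updates.\<close>

lemma tracking_error_le:
  assumes t: "t0 + int d \<le> t"
  shows "\<bar>y t - ystar t\<bar> \<le> f (t - int d) * (\<Sum>i<d. upd (t - int i))
    + (1 + 2 * \<sigma> / real_of_ereal \<delta>) * \<bar>wbar t\<bar>"
proof -
  let ?\<phi> = "\<phi> (t - int d)"
  obtain l where l: "d = Suc l" using d by (cases d) auto
  have "ystar t = \<theta>hat (t - int d) \<bullet> ?\<phi>" using control[of "t - int d"] t by simp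
  then have "y t - ystar t = e t + ?\<phi> \<bullet> (\<theta>hat (t - 1) - \<theta>hat (t - 1 - int l))"
    unfolding error_eq by (simp add: l inner_diff_right inner_commute algebra_simps)
  also have "\<bar>\<dots>\<bar> \<le> \<bar>e t\<bar> + norm ?\<phi> * norm (\<theta>hat (t - 1) - \<theta>hat (t - 1 - int l))"
    using Cauchy_Schwarz_ineq2[of ?\<phi> "\<theta>hat (t - 1) - \<theta>hat (t - 1 - int l)"] by linarith
  also have "\<dots> \<le> (norm ?\<phi> * upd t + (1 + 2 * \<sigma> / real_of_ereal \<delta>) * \<bar>wbar t\<bar>)
      + norm ?\<phi> * (\<Sum>i<l. upd (t - 1 - int i))"
  proof (intro add_mono mult_left_mono)
    show "norm (\<theta>hat (t - 1) - \<theta>hat (t - 1 - int l)) \<le> (\<Sum>i<l. upd (t - 1 - int i))"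
      by (rule \<theta>hat_drift) (use t l in simp)
    show "\<bar>e t\<bar> \<le> norm ?\<phi> * upd t + (1 + 2 * \<sigma> / real_of_ereal \<delta>) * \<bar>wbar t\<bar>"
      by (rule pred_error_le) (use t in simp)
  qed simp
  also have "\<dots> = norm ?\<phi> * (\<Sum>i<d. upd (t - int i)) + (1 + 2 * \<sigma> / real_of_ereal \<delta>) * \<bar>wbar t\<bar>"
    unfolding l sum.lessThan_Suc_shift by (simp add: algebra_simps)
  finally show ?thesis .
qed

end

end

subsection \<open>Convolution bound and tracking energy\<close>

text \<open>A sum of nonnegative terms, so that it dominates every constant demanded of
  \<open>C\<close> in \<open>discounted_loop\<close> at once.\<close>

definition loop_gain ::
  "nat \<Rightarrow> nat \<Rightarrow> nat \<Rightarrow> ereal \<Rightarrow> real \<Rightarrow> real \<Rightarrow> real \<Rightarrow> real \<Rightarrow> real \<Rightarrow> real \<Rightarrow> real" where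
  "loop_gain n m d \<delta> P \<sigma> \<beta>min bmin \<mu> L = 1 + step_gain n m d P \<sigma> \<beta>min / L
    + filter_gain n m d P bmin \<mu> L * (1 / L) ^ d + (1 + 2 * \<sigma> / real_of_ereal \<delta>) * (1 + P) ^ d"

lemma geometric_sum_int_le:
  fixes x :: real
  assumes x: "0 < x" "x < 1" and "s \<le> k"
  shows "(\<Sum>j\<in>{s<..k}. x powi (k - j)) \<le> 1 / (1 - x)"
  using assms(3)
proof (induction k rule: int_ge_induct)
  case base
  then show ?case using x by simp
next
  case (step k)
  have "(\<Sum>j\<in>{s<..k + 1}. x powi (k + 1 - j)) = (\<Sum>j\<in>{s<..k}. x * x powi (k - j)) + 1"
    using sum_greaterThanAtMost_int_last[of s "k + 1" "\<lambda>j. x powi (k + 1 - j)"] step.hyps x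
    by (simp add: power_int_add algebra_simps power_int_diff)
  also have "\<dots> \<le> x * (1 / (1 - x)) + 1"
    unfolding sum_distrib_left[symmetric] using step.IH x by (intro add_right_mono mult_left_mono) auto
  also have "\<dots> = 1 / (1 - x)" using x by (simp add: field_simps)
  finally show ?case .
qed

context adaptive_loop
begin

text \<open>As \<open>L \<le> 1\<close> the weights increase with time: replacing a weight by a
  later one is free, by an earlier one costs a power of \<open>1 / L\<close>. The output at
  \<open>t\<close> carries the weight of \<open>t - d\<close>, the time of the regressor that
  multiplies the updates in \<open>tracking_error_le\<close>.\<close>

lemma discounted_loop:
  fixes L \<mu> bmin :: real
  assumes \<theta>: "\<theta> \<in> S"
    and pred: "\<And>t. t0 - 1 + int d \<le> t \<Longrightarrow> y t = \<phi> (t - int d) \<bullet> \<theta> + wbar t"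
    and wbar: "\<And>t. \<bar>wbar t\<bar> \<le> (1 + P) ^ d * (\<Sum>i<d. \<bar>w (t - int i)\<bar>)"
    and L: "0 \<le> \<mu>" "\<mu> < L" "L \<le> 1"
    and b: "0 < bmin" "bmin \<le> \<bar>b_coef n \<theta>ab 0\<bar>"
    and zeros: "\<And>z. z \<in> B_zeros n m \<theta>ab \<Longrightarrow> cmod z \<le> \<mu>"
  shows "discounted_loop (loop_gain n m d \<delta> P \<sigma> \<beta>min bmin \<mu> L) (4 * \<sigma>\<^sup>2) d t0
    (\<lambda>t. L powi (-t) * f t) (\<lambda>t. L powi (-t) * r t) upd (\<lambda>t. (norm (\<theta>hat t - \<theta>))\<^sup>2)
    (\<lambda>t. L powi (-(t - int d)) * \<bar>y t\<bar>)"
proof -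
  define C where "C = loop_gain n m d \<delta> P \<sigma> \<beta>min bmin \<mu> L"
  define W where "W t = L powi (-t)" for t
  let ?E = "1 + 2 * \<sigma> / real_of_ereal \<delta>" and ?F = "(1 + P) ^ d"
  have L0: "0 < L" using L by simp
  have W0: "0 < W t" for t using L0 by (simp add: W_def)
  have W_shift: "W t = (1 / L) ^ i * W (t - int i)" for t i
    using L0 by (simp add: W_def power_int_diff power_int_minus field_simps)
  have W_mono: "W i \<le> W j" if "i \<le> j" for i j
    unfolding W_def using that L L0 by (intro power_int_decreasing) auto
  have E1: "1 \<le> ?E"
    using delta \<sigma>_nonneg by (simp add: real_of_ereal_pos)
  have F0: "0 \<le> ?F" using P_nonneg by simp
  then have EF: "?F \<le> ?E * ?F" using mult_right_mono[OF E1] by simp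
  have step0: "0 \<le> step_gain n m d P \<sigma> \<beta>min"
    unfolding step_gain_def using \<sigma>_nonneg \<beta>min P_nonneg by simp
  have "0 \<le> (3 / (1 - \<mu> / L)) ^ m" using L L0 by (simp add: field_simps)
  then have filter0: "0 \<le> filter_gain n m d P bmin \<mu> L"
    unfolding filter_gain_def using P_nonneg L0 b
    by (intro mult_nonneg_nonneg add_nonneg_nonneg divide_nonneg_pos) auto
  have C: "1 \<le> C" "step_gain n m d P \<sigma> \<beta>min / L \<le> C" "filter_gain n m d P bmin \<mu> L * (1 / L) ^ d \<le> C"
    "1 + ?E * ?F \<le> C" "?F \<le> C"
  proof -
    have "0 \<le> step_gain n m d P \<sigma> \<beta>min / L" "0 \<le> filter_gain n m d P bmin \<mu> L * (1 / L) ^ d"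
      using step0 filter0 L0 by simp_all
    then show "1 \<le> C" "step_gain n m d P \<sigma> \<beta>min / L \<le> C" "filter_gain n m d P bmin \<mu> L * (1 / L) ^ d \<le> C"
      "1 + ?E * ?F \<le> C" "?F \<le> C"
      unfolding C_def loop_gain_def using EF F0 by linarith+
  qed
  have q0: "0 \<le> W t * r s" for t s using W0[of t] by simp
  have wbar_le: "W (t - int d) * \<bar>wbar t\<bar> \<le> ?F * (\<Sum>i<d. W (t - int i) * r (t - int i))" for t
  proof -
    have "W (t - int d) * \<bar>wbar t\<bar> \<le> W (t - int d) * (?F * (\<Sum>i<d. \<bar>w (t - int i)\<bar>))"
      using wbar W0[of "t - int d"] by (intro mult_left_mono) auto
    also have "\<dots> = ?F * (\<Sum>i<d. W (t - int d) * \<bar>w (t - int i)\<bar>)"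
      by (simp add: sum_distrib_left mult_ac)
    also have "\<dots> \<le> ?F * (\<Sum>i<d. W (t - int i) * r (t - int i))"
      using F0 W0 by (intro mult_left_mono sum_mono mult_mono W_mono) (auto simp: less_imp_le)
    finally show ?thesis .
  qed
  have "discounted_loop C (4 * \<sigma>\<^sup>2) d t0 (\<lambda>t. W t * f t) (\<lambda>t. W t * r t) upd
      (\<lambda>t. (norm (\<theta>hat t - \<theta>))\<^sup>2) (\<lambda>t. W (t - int d) * \<bar>y t\<bar>)"
  proof
    fix t assume "t0 - 1 \<le> t"
    then have "(norm (\<theta>hat t - \<theta>))\<^sup>2 \<le> (2 * \<sigma>)\<^sup>2"
      using param_error_le[OF \<theta> pred] by (intro power_mono) auto
    then show "(norm (\<theta>hat t - \<theta>))\<^sup>2 \<le> 4 * \<sigma>\<^sup>2" by (simp add: power_mult_distrib)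
  next
    fix t assume t: "t0 \<le> t"
    have "W t * f t \<le> W t * (step_gain n m d P \<sigma> \<beta>min * (f (t - 1) + r t))"
      using W0[of t] by (intro mult_left_mono regressor_step t) auto
    also have "\<dots> = step_gain n m d P \<sigma> \<beta>min * (W t * f (t - 1) + 1 * (W t * r t))"
      by (simp add: algebra_simps)
    also have "W t * f (t - 1) = 1 / L * (W (t - 1) * f (t - 1))"
      using W_shift[of t 1] by simp
    also have "step_gain n m d P \<sigma> \<beta>min * (1 / L * (W (t - 1) * f (t - 1)) + 1 * (W t * r t)) \<le>
        step_gain n m d P \<sigma> \<beta>min * (1 / L * (W (t - 1) * f (t - 1)) + 1 / L * (W t * r t))"
      using step0 L0 L q0 by (intro mult_left_mono add_left_mono mult_right_mono) auto
    also have "\<dots> = step_gain n m d P \<sigma> \<beta>min / L * (W (t - 1) * f (t - 1) + W t * r t)"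
      by (simp add: algebra_simps)
    also have "\<dots> \<le> C * (W (t - 1) * f (t - 1) + W t * r t)"
      using C q0[of t t] W0[of "t - 1"] by (intro mult_right_mono) auto
    finally show "W t * f t \<le> C * (W (t - 1) * f (t - 1) + W t * r t)" .
  next
    fix s k assume sk: "t0 - 1 \<le> s" "s \<le> k"
    let ?Y = "\<lambda>t. W (t - int d) * \<bar>y t\<bar>" and ?i = "(1 / L) ^ d"
    have i1: "1 \<le> ?i" using L L0 by (intro one_le_power) auto
    have "W k * f k \<le> filter_gain n m d P bmin \<mu> L *
        (1 * (W s * f s) + (\<Sum>t\<in>{s<..k + int d}. W t * \<bar>y t\<bar> + 1 * (W t * r t)))"
      using regressor_filter[OF sk L b zeros] by (simp add: W_def)
    also have "\<dots> \<le> filter_gain n m d P bmin \<mu> L *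
        (?i * (W s * f s) + (\<Sum>t\<in>{s<..k + int d}. ?i * ?Y t + ?i * (W t * r t)))"
    proof (intro mult_left_mono[OF _ filter0] add_mono sum_mono)
      fix t show "W t * \<bar>y t\<bar> \<le> ?i * ?Y t" using W_shift[of t d] by simp
      show "1 * (W t * r t) \<le> ?i * (W t * r t)" by (rule mult_right_mono[OF i1 q0])
    next
      show "1 * (W s * f s) \<le> ?i * (W s * f s)"
        using W0[of s] by (intro mult_right_mono[OF i1]) auto
    qed
    also have "\<dots> = filter_gain n m d P bmin \<mu> L * ?i *
        (W s * f s + (\<Sum>t\<in>{s<..k + int d}. ?Y t + W t * r t))"
      by (simp only: distrib_left[symmetric] sum_distrib_left[symmetric] mult.assoc)
    also have "\<dots> \<le> C * (W s * f s + (\<Sum>t\<in>{s<..k + int d}. ?Y t + W t * r t))"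
      using C W0 by (intro mult_right_mono add_nonneg_nonneg sum_nonneg mult_nonneg_nonneg)
        (auto simp: less_imp_le)
    finally show "W k * f k \<le> C * (W s * f s + (\<Sum>t\<in>{s<..k + int d}. ?Y t + W t * r t))" .
  next
    fix t assume t: "t0 + int d \<le> t"
    let ?G = "\<Sum>i<d. upd (t - int i)" and ?Q = "\<Sum>i\<le>d. W (t - int i) * r (t - int i)"
    have Q: "(\<Sum>i<d. W (t - int i) * r (t - int i)) \<le> ?Q"
      using q0 by (intro sum_mono2) auto
    \<comment> \<open>The reference value at \<open>t\<close> belongs to \<open>r (t - d)\<close>,
      one lag more than the disturbance needs; hence the range \<open>i \<le> d\<close> in
      \<open>yb_le\<close>.\<close>
    have "W (t - int d) * \<bar>ystar t\<bar> \<le> W (t - int d) * r (t - int d)"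
      using W0[of "t - int d"] by (intro mult_left_mono) auto
    also have "\<dots> \<le> ?Q" using q0 by (intro member_le_sum) auto
    finally have ystar_le: "W (t - int d) * \<bar>ystar t\<bar> \<le> ?Q" .
    have "\<bar>y t\<bar> \<le> \<bar>ystar t\<bar> + (f (t - int d) * ?G + ?E * \<bar>wbar t\<bar>)"
      using tracking_error_le[OF \<theta> pred t] by linarith
    then have "W (t - int d) * \<bar>y t\<bar> \<le> W (t - int d) * (\<bar>ystar t\<bar> + (f (t - int d) * ?G + ?E * \<bar>wbar t\<bar>))"
      using W0[of "t - int d"] by (intro mult_left_mono) auto
    also have "\<dots> = W (t - int d) * f (t - int d) * ?G + W (t - int d) * \<bar>ystar t\<bar>
        + ?E * (W (t - int d) * \<bar>wbar t\<bar>)"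
      by (simp add: algebra_simps)
    also have "\<dots> \<le> W (t - int d) * f (t - int d) * ?G + ?Q + ?E * (?F * ?Q)"
      using E1 order_trans[OF wbar_le mult_left_mono[OF Q F0]] ystar_le W0[of "t - int d"]
      by (intro add_mono mult_left_mono) auto
    also have "\<dots> = W (t - int d) * f (t - int d) * ?G + (1 + ?E * ?F) * ?Q" by (simp add: algebra_simps)
    also have "\<dots> \<le> W (t - int d) * f (t - int d) * ?G + C * ?Q"
      using C q0 by (intro add_left_mono mult_right_mono sum_nonneg) auto
    finally show "W (t - int d) * \<bar>y t\<bar> \<le> W (t - int d) * f (t - int d) * ?G + C * ?Q" .
  next
    fix t assume t: "t0 + int d \<le> t"
    let ?Q = "\<Sum>i<d. W (t - int i) * r (t - int i)"
    have Q0: "0 \<le> ?Q" by (intro sum_nonneg q0)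
    have "\<bar>wbar t / f (t - int d)\<bar> = (W (t - int d) * \<bar>wbar t\<bar>) / (W (t - int d) * f (t - int d))"
      using W0[of "t - int d"] by (simp add: abs_divide)
    also have "\<dots> \<le> C * ?Q / (W (t - int d) * f (t - int d))"
      using order_trans[OF wbar_le mult_right_mono[OF C(5) Q0]] W0[of "t - int d"]
      by (intro divide_right_mono) auto
    finally have "\<bar>wbar t / f (t - int d)\<bar>\<^sup>2 \<le> (C * ?Q / (W (t - int d) * f (t - int d)))\<^sup>2"
      by (intro power_mono) auto
    then show "(norm (\<theta>hat t - \<theta>))\<^sup>2 \<le> (norm (\<theta>hat (t - 1) - \<theta>))\<^sup>2 - (upd t)\<^sup>2 / 2
        + 2 * (C * ?Q / (W (t - int d) * f (t - int d)))\<^sup>2"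
      using param_error_descent[OF \<theta> pred, of t] t unfolding power2_abs by linarith
  qed (use C q0 W0 upd_nonneg in \<open>auto simp: less_imp_le\<close>)
  then show ?thesis by (simp only: C_def W_def)
qed

section \<open>Square summability in the absence of disturbances\<close>

lemma update_energy_le:
  assumes \<theta>: "\<theta> \<in> S" and pred: "\<And>t. t0 - 1 + int d \<le> t \<Longrightarrow> y t = \<phi> (t - int d) \<bullet> \<theta>"
    and j: "t0 + int d - 2 \<le> j" "j \<le> k"
  shows "(\<Sum>t\<in>{j<..k}. (upd t)\<^sup>2) \<le> 8 * \<sigma>\<^sup>2"
proof -
  have pred0: "y t = \<phi> (t - int d) \<bullet> \<theta> + 0" if "t0 - 1 + int d \<le> t" for t
    using pred that by simp
  let ?V = "\<lambda>t. (norm (\<theta>hat t - \<theta>))\<^sup>2"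
  from j(2) have "(\<Sum>t\<in>{j<..k}. (upd t)\<^sup>2) \<le> 2 * (?V j - ?V k)"
  proof (induction k rule: int_ge_induct)
    case (step k)
    then show ?case
      using sum_greaterThanAtMost_int_last[of j "k + 1" "\<lambda>t. (upd t)\<^sup>2"]
        param_error_descent[OF \<theta> pred0, of "k + 1"] j(1) by simp
  qed simp
  also have "\<dots> \<le> 2 * (2 * \<sigma>)\<^sup>2"
  proof -
    have "?V j \<le> (2 * \<sigma>)\<^sup>2"
      using param_error_le[OF \<theta> pred0, of j] j d by (intro power_mono) auto
    then have "?V j - ?V k \<le> (2 * \<sigma>)\<^sup>2" by (rule diff_mono[of _ _ 0, simplified]) simp
    then show ?thesis by (rule mult_left_mono) simp
  qed
  finally show ?thesis by (simp add: power_mult_distrib)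
qed

text \<open>From \<open>t0 + 2 * d - 1\<close> on, all \<open>d\<close> updates in the tracking
  error lie after \<open>t0 + d - 1\<close>, where their energy is bounded. Cauchy-Schwarz
  contributes one factor \<open>d\<close>, the overlap of the windows the other.\<close>

lemma tracking_energy_le:
  assumes \<theta>: "\<theta> \<in> S" and pred: "\<And>t. t0 - 1 + int d \<le> t \<Longrightarrow> y t = \<phi> (t - int d) \<bullet> \<theta>"
    and D: "\<And>t. t0 \<le> t \<Longrightarrow> f t \<le> D"
  shows "(\<Sum>i<l. (ystar (t0 + 2 * int d - 1 + int i) - y (t0 + 2 * int d - 1 + int i))\<^sup>2)
    \<le> D\<^sup>2 * (8 * (real d)\<^sup>2 * \<sigma>\<^sup>2)"
proof -
  have pred0: "y t = \<phi> (t - int d) \<bullet> \<theta> + 0" if "t0 - 1 + int d \<le> t" for t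
    using pred that by simp
  let ?T = "\<lambda>i. t0 + 2 * int d - 1 + int i"
  have "(ystar t - y t)\<^sup>2 \<le> D\<^sup>2 * (real d * (\<Sum>i\<in>{..<d}. (upd (t - int i))\<^sup>2))" if t: "t0 + int d \<le> t" for t
  proof -
    have "\<bar>y t - ystar t\<bar> \<le> f (t - int d) * (\<Sum>i<d. upd (t - int i))"
      using tracking_error_le[OF \<theta> pred0 t] by simp
    also have "\<dots> \<le> D * (\<Sum>i<d. upd (t - int i))"
      using t by (intro mult_right_mono D sum_nonneg upd_nonneg) auto
    finally have "\<bar>y t - ystar t\<bar>\<^sup>2 \<le> (D * (\<Sum>i<d. upd (t - int i)))\<^sup>2"
      by (intro power_mono) auto
    also have "\<dots> \<le> D\<^sup>2 * (real d * (\<Sum>i\<in>{..<d}. (upd (t - int i))\<^sup>2))"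
      unfolding power_mult_distrib
      using sum_squared_le_sum_of_squares[of "\<lambda>i. upd (t - int i)" "{..<d}"]
      by (intro mult_left_mono) (auto simp: mult.commute)
    finally show ?thesis by (simp add: power2_commute)
  qed
  then have "(\<Sum>i<l. (ystar (?T i) - y (?T i))\<^sup>2) \<le>
      (\<Sum>i<l. D\<^sup>2 * (real d * (\<Sum>j\<in>{..<d}. (upd (?T i - int j))\<^sup>2)))"
    using d by (intro sum_mono) auto
  also have "\<dots> = (\<Sum>t\<in>?T ` {..<l}. D\<^sup>2 * (real d * (\<Sum>j\<in>{..<d}. (upd (t - int j))\<^sup>2)))"
    by (subst sum.reindex) (auto simp: inj_on_def)
  also have "\<dots> = D\<^sup>2 * (real d * (\<Sum>t\<in>?T ` {..<l}. \<Sum>j\<in>{..<d}. (upd (t - int j))\<^sup>2))"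
    by (simp only: sum_distrib_left)
  also have "\<dots> \<le> D\<^sup>2 * (real d * (real (card {..<d}) * (\<Sum>t\<in>{t0 + int d - 1<..?T l}. (upd t)\<^sup>2)))"
    by (intro mult_left_mono sum_lag_le) auto
  also have "\<dots> \<le> D\<^sup>2 * (real d * (real (card {..<d}) * (8 * \<sigma>\<^sup>2)))"
    by (intro mult_left_mono update_energy_le[OF \<theta> pred]) auto
  finally show ?thesis by (simp add: power2_eq_square mult_ac)
qed

text \<open>The discount is undone: the rate \<open>lam / L\<close> from \<open>exp_bound\<close>,
  multiplied by the rate \<open>L\<close> of the weights, is \<open>lam\<close>.\<close>

lemma regressor_bound:
  fixes L \<mu> bmin lam C K eps M :: real
  assumes \<theta>: "\<theta> \<in> S"
    and pred: "\<And>t. t0 - 1 + int d \<le> t \<Longrightarrow> y t = \<phi> (t - int d) \<bullet> \<theta> + wbar t"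
    and wbar: "\<And>t. \<bar>wbar t\<bar> \<le> (1 + P) ^ d * (\<Sum>i<d. \<bar>w (t - int i)\<bar>)"
    and L: "0 \<le> \<mu>" "\<mu> < L" "L < lam" "lam \<le> 1"
    and b: "0 < bmin" "bmin \<le> \<bar>b_coef n \<theta>ab 0\<bar>"
    and zeros: "\<And>z. z \<in> B_zeros n m \<theta>ab \<Longrightarrow> cmod z \<le> \<mu>"
    and k: "t0 - 1 \<le> k"
    and C: "C = loop_gain n m d \<delta> P \<sigma> \<beta>min bmin \<mu> L"
    and K: "K = (d + 4) * C ^ (3 * d + 2)" and eps: "eps = ln (lam / L) / (2 * K * d)"
    and M: "M = max (2 * C) (C * d * (2 * C) ^ d / eps)"
  shows "f k \<le> exp (K * d * (4 * \<sigma>\<^sup>2) / (2 * eps)) * K * M * exp_conv lam (f (t0 - 1)) (t0 - 1) r k"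
proof -
  interpret discounted_loop C "4 * \<sigma>\<^sup>2" d t0 "\<lambda>t. L powi (-t) * f t" "\<lambda>t. L powi (-t) * r t" upd
      "\<lambda>t. (norm (\<theta>hat t - \<theta>))\<^sup>2" "\<lambda>t. L powi (-(t - int d)) * \<bar>y t\<bar>"
    unfolding C by (rule discounted_loop) (use \<theta> pred wbar L b zeros in auto)
  let ?c = "exp (K * d * (4 * \<sigma>\<^sup>2) / (2 * eps)) * K * M"
  have L0: "0 < L" using L by simp
  have scale: "L powi k * ((lam / L) powi (k - j) * (L powi (-j) * x)) = lam powi (k - j) * x" for j x
  proof -
    have "L powi k * (L powi (-j)) = L powi (k - j)"
      using L0 power_int_add[of L k "-j"] by simp
    then have "L powi k * ((lam / L) powi (k - j) * (L powi (-j) * x)) =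
        L powi (k - j) * (lam / L) powi (k - j) * x"
      by (metis mult.assoc mult.left_commute)
    also have "L powi (k - j) * (lam / L) powi (k - j) = lam powi (k - j)"
      using L0 by (simp flip: power_int_mult_distrib)
    finally show ?thesis .
  qed
  have "L powi (-k) * f k \<le>
      ?c * exp_conv (lam / L) (L powi (-(t0 - 1)) * f (t0 - 1)) (t0 - 1) (\<lambda>t. L powi (-t) * r t) k"
    by (rule exp_bound[OF _ d _ k K eps M]) (use L L0 in auto)
  then have "L powi k * (L powi (-k) * f k) \<le> L powi k *
      (?c * exp_conv (lam / L) (L powi (-(t0 - 1)) * f (t0 - 1)) (t0 - 1) (\<lambda>t. L powi (-t) * r t) k)"
    using L0 by (intro mult_left_mono) auto
  also have "L powi k * (L powi (-k) * f k) = f k"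
    using L0 by (simp add: power_int_minus)
  also have "L powi k *
      (?c * exp_conv (lam / L) (L powi (-(t0 - 1)) * f (t0 - 1)) (t0 - 1) (\<lambda>t. L powi (-t) * r t) k) =
      ?c * (L powi k * ((lam / L) powi (k - (t0 - 1)) * (L powi (-(t0 - 1)) * f (t0 - 1))) +
        (\<Sum>j\<in>{t0 - 1<..k}. L powi k * ((lam / L) powi (k - j) * (L powi (-j) * r j))))"
    unfolding exp_conv_def distrib_left sum_distrib_left by (simp only: mult.left_commute)
  also have "\<dots> = ?c * exp_conv lam (f (t0 - 1)) (t0 - 1) r k"
    unfolding scale exp_conv_def ..
  finally show ?thesis .
qed

end

lemma norm_regressor_le_plant_init:
  assumes d: "1 \<le> d" and card_p: "CARD('p::finite) = n + m + d"
    and card_r: "CARD('r::finite) = (n + d - 1) + (m + 2 * d - 1)"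
  shows "norm (regressor n y u (t0 - 1) :: real ^ 'p) \<le>
    real (n + m + d) * norm (plant_init n d y u t0 :: real ^ 'r)"
proof -
  let ?x = "plant_init n d y u t0 :: real ^ 'r"
  have "norm (regressor n y u (t0 - 1) :: real ^ 'p) \<le>
      (\<Sum>i<n. \<bar>y (t0 - 1 - int i)\<bar>) + (\<Sum>i<m + d. \<bar>u (t0 - 1 - int i)\<bar>)"
    by (rule norm_regressor_le) (simp add: card_p)
  also have "\<dots> \<le> (\<Sum>i<n. norm ?x) + (\<Sum>i<m + d. norm ?x)"
  proof (intro add_mono sum_mono)
    fix i assume "i \<in> {..<n}"
    then have "i < n + d - 1" using d by simp
    then show "\<bar>y (t0 - 1 - int i)\<bar> \<le> norm ?x"
      using abs_coord_le_norm[of ?x i] by (simp add: plant_init_def coord_mkvec card_r)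
  next
    fix i assume "i \<in> {..<m + d}"
    then have "n + d - 1 + i < CARD('r)" using d by (simp add: card_r)
    then have "coord ?x (n + d - 1 + i) = u (t0 - 1 - int i)"
      unfolding plant_init_def by (subst coord_mkvec) auto
    then show "\<bar>u (t0 - 1 - int i)\<bar> \<le> norm ?x"
      using abs_coord_le_norm[of ?x "n + d - 1 + i"] by simp
  qed
  also have "\<dots> = real (n + m + d) * norm ?x" by (simp add: algebra_simps)
  finally show ?thesis .
qed

lemma compact_abs_coord_lower_bound:
  fixes K :: "(real ^ 'k::finite) set"
  assumes "compact K" "\<And>v. v \<in> K \<Longrightarrow> coord v i \<noteq> 0"
  obtains c where "0 < c" "\<And>v. v \<in> K \<Longrightarrow> c \<le> \<bar>coord v i\<bar>"
proof (cases "K = {}")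
  case False
  have "continuous_on K (\<lambda>v. \<bar>coord v i\<bar>)"
    by (intro continuous_on_rabs continuous_on_coord)
  then obtain x where "x \<in> K" "\<And>v. v \<in> K \<Longrightarrow> \<bar>coord x i\<bar> \<le> \<bar>coord v i\<bar>"
    using continuous_attains_inf[OF assms(1) False] by blast
  then show ?thesis using assms(2) by (intro that[of "\<bar>coord x i\<bar>"]) auto
qed (use that[of 1] in auto)

theorem theorem1:
  fixes n m d :: nat
    and Sab :: "(real ^ 'q::finite) set"
    and S :: "(real ^ 'p::finite) set"
    and \<delta> :: ereal and lam :: real
  assumes d: "d \<ge> 1"
    and card_q: "CARD('q) = n + m + 1"
    and card_p: "CARD('p) = n + m + d"
    and card_r: "CARD('r::finite) = (n + d - 1) + (m + 2 * d - 1)"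
    and Sab_compact: "compact Sab"
    and b0_nonzero: "\<forall>\<theta>ab\<in>Sab. b_coef n \<theta>ab 0 \<noteq> 0"
    and b0_sign: "\<forall>\<theta>ab\<in>Sab. \<forall>\<theta>ab'\<in>Sab. sgn (b_coef n \<theta>ab 0) = sgn (b_coef n \<theta>ab' 0)"
    and min_phase: "\<forall>\<theta>ab\<in>Sab. \<forall>z\<in>B_zeros n m \<theta>ab. cmod z < 1"
    and S_compact: "compact S" and S_convex: "convex S"
    and S_contains: "S_alphabeta n m d Sab \<subseteq> S"
    and S_beta0: "\<forall>\<theta>\<in>S. coord \<theta> n \<noteq> 0"
    and delta: "0 < \<delta>"
    and lam: "lambda_low n m Sab < lam" "lam < 1"
  shows "\<exists>c>0. \<forall>t0 :: int. \<forall>\<theta>ab\<in>Sab. \<forall>ystar w :: int \<Rightarrow> real. \<forall>\<theta>0\<in>S. \<forall>x0 :: real ^ 'r.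
           \<forall>y u :: int \<Rightarrow> real. \<forall>\<theta>hat :: int \<Rightarrow> real ^ 'p.
           bounded (range ystar) \<longrightarrow> bounded (range w) \<longrightarrow>
           plant_init n d y u t0 = x0 \<longrightarrow>
           closed_loop n m d \<theta>ab \<delta> S t0 \<theta>0 ystar w y u \<theta>hat \<longrightarrow>
           (\<forall>k\<ge>t0. norm (regressor n y u k :: real ^ 'p) \<le>
              c * lam ^ nat (k - t0) * norm x0 +
              (\<Sum>j = t0..k. c * lam ^ nat (k - j) * (\<bar>ystar (j + int d)\<bar> + \<bar>w j\<bar>))) \<and>
           ((\<forall>j. w j = 0) \<longrightarrow>
              summable (\<lambda>i. (ystar (t0 + 2 * int d - 1 + int i) - y (t0 + 2 * int d - 1 + int i))\<^sup>2) \<and>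
              (\<Sum>i. (ystar (t0 + 2 * int d - 1 + int i) - y (t0 + 2 * int d - 1 + int i))\<^sup>2)
                \<le> c * ((norm x0)\<^sup>2 + (SUP j\<in>{t0..}. \<bar>ystar j\<bar>\<^sup>2)))"
proof (cases "Sab = {} \<or> S = {}")
  case True
  then show ?thesis by (intro exI[of _ 1]) auto
next
  case False
  obtain P where P_bound: "\<And>\<theta>ab. \<theta>ab \<in> Sab \<Longrightarrow> norm \<theta>ab \<le> P"
    using compact_imp_bounded[OF Sab_compact] by (auto simp: bounded_iff)
  obtain bmin where bmin: "0 < bmin" "\<And>\<theta>ab. \<theta>ab \<in> Sab \<Longrightarrow> bmin \<le> \<bar>coord \<theta>ab n\<bar>"
    using b0_nonzero by (auto simp: b_coef_def intro: compact_abs_coord_lower_bound[OF Sab_compact, of n])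
  obtain \<beta>min where \<beta>min: "0 < \<beta>min" "\<And>\<theta>. \<theta> \<in> S \<Longrightarrow> \<beta>min \<le> \<bar>coord \<theta> n\<bar>"
    using S_beta0 by (auto intro: compact_abs_coord_lower_bound[OF S_compact, of n])
  define \<mu> where "\<mu> = lambda_low n m Sab"
  \<comment> \<open>Boundedness is what makes \<open>Sup\<close> in \<open>lambda_low\<close> an
    upper bound of the moduli.\<close>
  have "bdd_above (insert 0 (\<Union>\<theta>ab\<in>Sab. cmod ` B_zeros n m \<theta>ab))"
    using min_phase by (intro bdd_aboveI[of _ 1]) (auto simp: less_imp_le)
  then have upper: "x \<le> \<mu>" if "x \<in> insert 0 (\<Union>\<theta>ab\<in>Sab. cmod ` B_zeros n m \<theta>ab)" for x
    unfolding \<mu>_def lambda_low_def by (rule cSup_upper[OF that])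
  have \<mu>0: "0 \<le> \<mu>" by (rule upper) simp
  have zeros: "cmod z \<le> \<mu>" if "\<theta>ab \<in> Sab" "z \<in> B_zeros n m \<theta>ab" for \<theta>ab z
    by (rule upper) (use that in blast)
  \<comment> \<open>The gap below \<open>L\<close> makes the discounted inverse of \<open>B\<close>
    summable; the gap above \<open>L\<close> is spent on the adaptation.\<close>
  define L where "L = (\<mu> + lam) / 2"
  have L: "\<mu> < L" "L < lam" "lam \<le> 1" using lam by (simp_all add: L_def \<mu>_def)
  have lam0: "0 < lam" using \<mu>0 L by simp
  define \<sigma> where "\<sigma> = set_norm S"
  define C where "C = loop_gain n m d \<delta> P \<sigma> \<beta>min bmin \<mu> L"
  define K where "K = (d + 4) * C ^ (3 * d + 2)"
  define eps where "eps = ln (lam / L) / (2 * K * d)"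
  define M where "M = max (2 * C) (C * d * (2 * C) ^ d / eps)"
  define c1 where "c1 = exp (K * d * (4 * \<sigma>\<^sup>2) / (2 * eps)) * K * M"
  define N where "N = real (n + m + d)"
  \<comment> \<open>The absolute value spares a discussion of the sign of \<open>c1\<close>, and
    \<open>N\<close> converts \<open>\<phi> (t0 - 1)\<close> into the initial condition.\<close>
  define c2 where "c2 = \<bar>c1\<bar> * (N + 1)"
  define g where "g = 8 * (real d)\<^sup>2 * \<sigma>\<^sup>2"
  \<comment> \<open>The first summand serves the convolution bound. The second serves the tracking
    energy: the squared bound on the regressor, with 2 from the square of a sum. The 1 gives
    positivity.\<close>
  define c where "c = c2 + 2 * (c2 / (1 - lam))\<^sup>2 * g + 1"
  have c2_nonneg: "0 \<le> c2" and g0: "0 \<le> g" by (simp_all add: c2_def N_def g_def)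
  have c_c2: "c2 \<le> c" and c0: "0 < c" using c2_nonneg g0 by (simp_all add: c_def add_nonneg_pos)
  show ?thesis
  proof (intro exI[of _ c] conjI c0 allI ballI impI)
    fix t0 :: int and \<theta>ab ystar w and \<theta>0 :: "real ^ 'p" and x0 :: "real ^ 'r" and y u \<theta>hat
    assume \<theta>ab: "\<theta>ab \<in> Sab" and \<theta>0: "\<theta>0 \<in> S"
      and ystar: "bounded (range ystar)" and x0: "plant_init n d y u t0 = x0"
      and loop: "closed_loop n m d \<theta>ab \<delta> S t0 \<theta>0 ystar w y u \<theta>hat"
    define \<phi> :: "int \<Rightarrow> real ^ 'p" where "\<phi> = regressor n y u"
    have S_sub: "S_alphabeta n m d {\<theta>ab} \<subseteq> S"
      using S_contains \<theta>ab unfolding S_alphabeta_def by blast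
    interpret adaptive_loop n m d \<theta>ab \<delta> S t0 \<theta>0 ystar w y u \<theta>hat P \<beta>min \<phi>
      by standard (use d card_p S_compact S_convex S_sub \<beta>min P_bound[OF \<theta>ab] delta \<theta>0 loop \<phi>_def in auto)
    obtain \<theta> wbar where \<theta>': "\<theta> \<in> S_alphabeta n m d {\<theta>ab}"
      and pred: "\<And>t. t0 - 1 + int d \<le> t \<Longrightarrow> y t = \<phi> (t - int d) \<bullet> \<theta> + wbar t"
      and wbar: "\<And>t. \<bar>wbar t\<bar> \<le> (1 + P) ^ d * (\<Sum>i<d. \<bar>w (t - int i)\<bar>)"
      unfolding \<phi>_def using predictor_form[OF d card_p P_bound[OF \<theta>ab] plant] by blast
    have \<theta>: "\<theta> \<in> S" using \<theta>' S_sub by blast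
    have bound: "f k \<le> c2 * (lam ^ nat (k - t0) * norm x0 + (\<Sum>j\<in>{t0 - 1<..k}. lam powi (k - j) * r j))"
      if k: "t0 \<le> k" for k
    proof -
      let ?R = "\<Sum>j\<in>{t0 - 1<..k}. lam powi (k - j) * r j"
      have R0: "0 \<le> ?R" using lam0 by (auto intro!: sum_nonneg)
      have "f k \<le> c1 * exp_conv lam (f (t0 - 1)) (t0 - 1) r k"
        unfolding c1_def \<sigma>_def
        by (rule regressor_bound[OF \<theta> pred wbar \<mu>0 L bmin(1) _ zeros[OF \<theta>ab], of _ C])
          (use bmin(2)[OF \<theta>ab] k C_def K_def eps_def M_def \<sigma>_def in \<open>auto simp: b_coef_def\<close>)
      also have "\<dots> \<le> \<bar>c1\<bar> * (lam powi (k - (t0 - 1)) * f (t0 - 1) + ?R)"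
        unfolding exp_conv_def using R0 lam0 by (intro mult_right_mono) auto
      also have "\<dots> \<le> \<bar>c1\<bar> * (lam ^ nat (k - t0) * (N * norm x0) + ?R)"
      proof (intro mult_left_mono add_right_mono mult_mono)
        have "lam powi (k - (t0 - 1)) \<le> lam powi (k - t0)"
          using lam0 L k by (intro power_int_decreasing) auto
        then show "lam powi (k - (t0 - 1)) \<le> lam ^ nat (k - t0)"
          using k by (simp add: power_int_def)
        show "f (t0 - 1) \<le> N * norm x0"
          unfolding \<phi>_def N_def x0[symmetric]
          by (rule norm_regressor_le_plant_init[OF d card_p card_r])
      qed (use lam0 in auto)
      also have "\<dots> \<le> \<bar>c1\<bar> * ((N + 1) * (lam ^ nat (k - t0) * norm x0 + ?R))"
        using R0 lam0 by (intro mult_left_mono) (auto simp: N_def algebra_simps)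
      finally show ?thesis by (simp add: c2_def mult.assoc)
    qed
    {
      fix k assume k: "t0 \<le> k"
      note bound[OF k]
      also have "c2 * (lam ^ nat (k - t0) * norm x0 + (\<Sum>j\<in>{t0 - 1<..k}. lam powi (k - j) * r j)) \<le>
          c * (lam ^ nat (k - t0) * norm x0 + (\<Sum>j\<in>{t0 - 1<..k}. lam powi (k - j) * r j))"
        using c_c2 lam0 by (intro mult_right_mono add_nonneg_nonneg sum_nonneg mult_nonneg_nonneg) auto
      also have "(\<Sum>j\<in>{t0 - 1<..k}. lam powi (k - j) * r j) = (\<Sum>j = t0..k. lam ^ nat (k - j) * r j)"
        by (rule sum.cong) (auto simp: power_int_def)
      finally show "norm (regressor n y u k :: real ^ 'p) \<le> c * lam ^ nat (k - t0) * norm x0 +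
          (\<Sum>j = t0..k. c * lam ^ nat (k - j) * r j)"
        unfolding \<phi>_def by (simp add: distrib_left sum_distrib_left mult.assoc)
    }
    assume "\<forall>j. w j = 0"
    then have w: "w j = 0" for j by blast
    have pred0: "y t = \<phi> (t - int d) \<bullet> \<theta>" if "t0 - 1 + int d \<le> t" for t
      using pred[OF that] wbar[of t] by (simp add: w)
    define Y2 where "Y2 = (SUP j\<in>{t0..}. \<bar>ystar j\<bar>\<^sup>2)"
    \<comment> \<open>Boundedness of the reference makes the supremum in the energy bound a genuine
      upper bound.\<close>
    obtain B where B: "\<And>j. \<bar>ystar j\<bar> \<le> B" using ystar by (auto simp: bounded_iff)
    have Y2: "\<bar>ystar j\<bar>\<^sup>2 \<le> Y2" if "t0 \<le> j" for j
      unfolding Y2_def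
    proof (rule cSUP_upper)
      show "bdd_above ((\<lambda>j. \<bar>ystar j\<bar>\<^sup>2) ` {t0..})"
        by (intro bdd_aboveI2[of _ _ "B\<^sup>2"] power_mono B) auto
    qed (use that in simp)
    have Y0: "0 \<le> Y2" using Y2[of t0] zero_le_power2 order_trans by blast
    have r_le: "r j \<le> sqrt Y2" if "t0 \<le> j" for j
      using Y2[of "j + int d"] that by (simp add: w real_le_rsqrt)
    define D where "D = c2 / (1 - lam) * (norm x0 + sqrt Y2)"
    have fD: "f k \<le> D" if k: "t0 \<le> k" for k
    proof -
      have "(\<Sum>j\<in>{t0 - 1<..k}. lam powi (k - j) * r j) \<le> (\<Sum>j\<in>{t0 - 1<..k}. lam powi (k - j) * sqrt Y2)"
        using lam0 r_le by (intro sum_mono mult_left_mono) auto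
      also have "\<dots> = (\<Sum>j\<in>{t0 - 1<..k}. lam powi (k - j)) * sqrt Y2"
        by (simp add: sum_distrib_right)
      also have "\<dots> \<le> 1 / (1 - lam) * sqrt Y2"
        using lam0 lam k Y0 by (intro mult_right_mono geometric_sum_int_le) auto
      finally have 1: "(\<Sum>j\<in>{t0 - 1<..k}. lam powi (k - j) * r j) \<le> 1 / (1 - lam) * sqrt Y2" .
      have "lam ^ nat (k - t0) \<le> 1" using lam0 L by (intro power_le_one) auto
      also have "1 \<le> 1 / (1 - lam)" using lam0 lam by simp
      finally have 2: "lam ^ nat (k - t0) * norm x0 \<le> 1 / (1 - lam) * norm x0"
        by (intro mult_right_mono) auto
      have "f k \<le> c2 * (1 / (1 - lam) * norm x0 + 1 / (1 - lam) * sqrt Y2)"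
        using 1 2 c2_nonneg by (intro order_trans[OF bound[OF k]] mult_left_mono) auto
      then show ?thesis by (simp add: D_def distrib_left add_divide_distrib)
    qed
    have "D\<^sup>2 * g \<le> c * ((norm x0)\<^sup>2 + Y2)"
    proof -
      have "(norm x0 + sqrt Y2)\<^sup>2 \<le> 2 * ((norm x0)\<^sup>2 + Y2)"
        using zero_le_power2[of "norm x0 - sqrt Y2"] Y0
        by (simp add: power2_eq_square algebra_simps)
      then have "D\<^sup>2 * g \<le> ((c2 / (1 - lam))\<^sup>2 * (2 * ((norm x0)\<^sup>2 + Y2))) * g"
        unfolding D_def power_mult_distrib using g0 by (intro mult_right_mono mult_left_mono) auto
      also have "\<dots> = (2 * (c2 / (1 - lam))\<^sup>2 * g) * ((norm x0)\<^sup>2 + Y2)" by (simp add: mult_ac)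
      also have "\<dots> \<le> c * ((norm x0)\<^sup>2 + Y2)"
        using c2_nonneg Y0 by (intro mult_right_mono) (auto simp: c_def)
      finally show ?thesis .
    qed
    then have partial: "(\<Sum>i<l. (ystar (t0 + 2 * int d - 1 + int i) - y (t0 + 2 * int d - 1 + int i))\<^sup>2)
        \<le> c * ((norm x0)\<^sup>2 + Y2)" for l
      using tracking_energy_le[OF \<theta> pred0 fD, of l] by (simp add: g_def \<sigma>_def)
    show "summable (\<lambda>i. (ystar (t0 + 2 * int d - 1 + int i) - y (t0 + 2 * int d - 1 + int i))\<^sup>2)"
      by (rule summableI_nonneg_bounded[OF _ partial]) simp
    then show "(\<Sum>i. (ystar (t0 + 2 * int d - 1 + int i) - y (t0 + 2 * int d - 1 + int i))\<^sup>2)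
        \<le> c * ((norm x0)\<^sup>2 + (SUP j\<in>{t0..}. \<bar>ystar j\<bar>\<^sup>2))"
      using suminf_le_const[OF _ partial] by (simp add: Y2_def)
  qed
qed

end
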